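(* Fix one of the two systems (R1), (R2) described in the context (with given $W,V,K,\tau$). There exists a unique function $v:\mathbb{R}\to\mathbb{R}$ (called the transport speed, depending on $W,V,K$), and $v$ is continuous, such that the following holds. For every $u^0\in\mathbb{R}^{\mathbb{Z}}$ of bounded width with mean spacing $\rho\in\mathbb{R}$ and integer constant $n\ge 1$, i.e. such that $|u^0_{j+k}-u^0_j-k\rho|\le n$ for all $j,k\in\mathbb{Z}$, $k\ge 1$, for every $k,m\in\mathbb{Z}$ with $m\ge 1$, and every $t_0\in\mathbb{R}$, if $u(t)$ is the solution of the chosen system with $u(t_0)=u^0$, then $$\left|\frac{u_k(t_0+2m\tau)-u_k(t_0)}{2m\tau}-v(\rho)\right|\le\frac{n+2}{2m\tau}.$$
   Context: Standing assumptions: $W,V:\mathbb{R}\to\mathbb{R}$ are $C^2$; $W''$ is positive and bounded away from zero; $V(x+1)=V(x)$ for all $x$; $\tau>0$; $K:\mathbb{R}\to\mathbb{R}$ is piecewise continuous, bounded and periodic with period $2\tau$. The two systems are, for $k\in\mathbb{Z}$, (R1) $\quad \frac{d}{dt}u_k(t)=W'(u_{k+1}-u_k)-W'(u_k-u_{k-1})+K(t)V'(u_k)$, (R2) $\quad \frac{d}{dt}u_k(t)=K(t)\left[W'(u_{k+1}-u_k)-W'(u_k-u_{k-1})\right]+V'(u_k)$. In the case (R2) it is assumed in addition that $K$ is bounded below by a positive constant. Solutions are considered in the space of configurations $u\in\mathbb{R}^{\mathbb{Z}}$ of bounded spacing, $\sup_k|u_{k+1}-u_k|<\infty$. *)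

theory Defs
  imports "HOL-Analysis.Analysis"
begin

definition C2 :: "(real \<Rightarrow> real) \<Rightarrow> bool" where
  "C2 f \<longleftrightarrow> (\<forall>x. f differentiable (at x)) \<and> (\<forall>x. deriv f differentiable (at x))
     \<and> continuous_on UNIV (deriv (deriv f))"

text \<open>The value at a discontinuity is arbitrary.\<close>

definition piecewise_continuous :: "(real \<Rightarrow> real) \<Rightarrow> bool" where
  "piecewise_continuous f \<longleftrightarrow>
     (\<forall>a b. finite {x \<in> {a..b}. \<not> isCont f x}) \<and>
     (\<forall>x. (\<exists>l. (f \<longlongrightarrow> l) (at_left x)) \<and> (\<exists>r. (f \<longlongrightarrow> r) (at_right x)))"

datatype lattice_system = R1 | R2

definition interaction :: "(real \<Rightarrow> real) \<Rightarrow> (int \<Rightarrow> real) \<Rightarrow> int \<Rightarrow> real" where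
  "interaction W u k = deriv W (u (k + 1) - u k) - deriv W (u k - u (k - 1))"

fun vector_field ::
  "lattice_system \<Rightarrow> (real \<Rightarrow> real) \<Rightarrow> (real \<Rightarrow> real) \<Rightarrow> (real \<Rightarrow> real)
    \<Rightarrow> real \<Rightarrow> (int \<Rightarrow> real) \<Rightarrow> int \<Rightarrow> real" where
  "vector_field R1 W V K t u k = interaction W u k + K t * deriv V (u k)"
| "vector_field R2 W V K t u k = K t * interaction W u k + deriv V (u k)"

text \<open>
  Forward solution \<open>u t k\<close> from time \<open>t\<^sub>0\<close>. Since \<open>K\<close> may jump, each coordinate is
  required to be continuous and to satisfy the equation at every time at which \<open>K\<close> is
  continuous (at \<open>t\<^sub>0\<close> the derivative is one-sided). The spacing is bounded at each time,
  locally uniformly in time; equivalently, \<open>u\<close> is a continuous curve with respect to the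
  distance \<open>sup\<^sub>k |u\<^sub>k - w\<^sub>k|\<close> in the space of configurations of bounded spacing.
\<close>

definition is_solution ::
  "lattice_system \<Rightarrow> (real \<Rightarrow> real) \<Rightarrow> (real \<Rightarrow> real) \<Rightarrow> (real \<Rightarrow> real)
    \<Rightarrow> real \<Rightarrow> (real \<Rightarrow> int \<Rightarrow> real) \<Rightarrow> bool" where
  "is_solution S W V K t\<^sub>0 u \<longleftrightarrow>
     (\<forall>T. \<exists>B. \<forall>t\<in>{t\<^sub>0..T}. \<forall>k. \<bar>u t (k + 1) - u t k\<bar> \<le> B) \<and>
     (\<forall>k. continuous_on {t\<^sub>0..} (\<lambda>t. u t k)) \<and>
     (\<forall>t\<ge>t\<^sub>0. isCont K t \<longrightarrow>
        (\<forall>k. ((\<lambda>s. u s k) has_real_derivative vector_field S W V K t (u t) k)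
               (at t within {t\<^sub>0..})))"

definition bounded_width :: "real \<Rightarrow> int \<Rightarrow> (int \<Rightarrow> real) \<Rightarrow> bool" where
  "bounded_width \<rho> n u \<longleftrightarrow>
     (\<forall>j k. k \<ge> 1 \<longrightarrow> \<bar>u (j + k) - u j - of_int k * \<rho>\<bar> \<le> of_int n)"

definition is_transport_speed ::
  "lattice_system \<Rightarrow> (real \<Rightarrow> real) \<Rightarrow> (real \<Rightarrow> real) \<Rightarrow> (real \<Rightarrow> real)
    \<Rightarrow> real \<Rightarrow> (real \<Rightarrow> real) \<Rightarrow> bool" where
  "is_transport_speed S W V K \<tau> v \<longleftrightarrow>
     (\<forall>u0 \<rho> n k m t\<^sub>0 u.
        n \<ge> 1 \<longrightarrow> bounded_width \<rho> n u0 \<longrightarrow> m \<ge> (1::int) \<longrightarrow>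
        is_solution S W V K t\<^sub>0 u \<longrightarrow> u t\<^sub>0 = u0 \<longrightarrow>
        \<bar>(u (t\<^sub>0 + 2 * of_int m * \<tau>) k - u t\<^sub>0 k) / (2 * of_int m * \<tau>) - v \<rho>\<bar>
          \<le> (of_int n + 2) / (2 * of_int m * \<tau>))"

end

theory Submission
  imports Defs "HOL-Library.Periodic_Fun" "HOL-Probability.Discrete_Topology"
begin

text \<open>
  Both systems have the form
  \<open>u\<^sub>k' = p(t) (g(u\<^sub>k\<^sub>+\<^sub>1 - u\<^sub>k) - g(u\<^sub>k - u\<^sub>k\<^sub>-\<^sub>1)) + q(t) h(u\<^sub>k)\<close> with \<open>g = W'\<close> increasing,
  \<open>h = V'\<close> of period 1 and \<open>p \<ge> 0\<close>, \<open>q\<close> of period \<open>T = 2\<tau>\<close>.  The proof rests on monotonicity: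
  the right-hand side at \<open>k\<close> increases with the neighbours of \<open>u\<^sub>k\<close>, so solutions that are
  ordered at one time remain ordered (\<open>comparison\<close>).  Shifting the index and adding an
  integer map solutions to solutions, so an inequality \<open>u\<^sub>k\<^sub>+\<^sub>i \<le> w\<^sub>k\<^sub>+\<^sub>j + n\<close> for all \<open>k\<close>, with
  \<open>n\<close> an integer, is kept for all later times as well (\<open>comparison_shifted\<close>).
  
  Let \<open>F\<^sub>m(\<theta>)\<close> be the distance that particle 0 travels in \<open>m\<close> periods from the linear
  configuration \<open>\<theta> + k\<rho>\<close>, the initial time being fixed.
  Comparing a linear solution with its own index shifts, moved by the integers next to \<open>j\<rho>\<close>,
  shows that at all later times it stays within 1 of the linear configuration of slope \<open>\<rho>\<close>
  through any of its particles (\<open>linear_spacing\<close>).  Comparing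
  linear solutions with different \<open>\<theta>\<close> gives \<open>\<bar>F\<^sub>m(\<theta>) - F\<^sub>m(\<theta>')\<bar> \<le> 1\<close>.  The two facts together
  give \<open>\<bar>F\<^sub>m\<^sub>+\<^sub>l(\<theta>) - F\<^sub>m(\<theta>) - F\<^sub>l(\<theta>)\<bar> \<le> 2\<close>, and a sequence that is additive up to 2 is linear up to
  2 (\<open>quasi_additive_imp_near_linear\<close>).  Its slope is the advance per period \<open>T v(\<rho>)\<close>.
  A solution whose initial configuration has width \<open>n\<close> starts within \<open>n\<close> of the linear
  configuration of slope \<open>\<rho>\<close> through its particle \<open>k\<close>, and so it stays within \<open>n\<close> of that linear
  solution; this gives the error \<open>n + 2\<close> (\<open>sol_near_advance\<close>).
  
  The advance does not depend on the initial time, because a linear solution has width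
  1 at every later time, so it can be used from both times, and velocities are bounded
  (\<open>advance_time\<close>).  It is continuous in \<open>\<rho>\<close> because the displacements over \<open>m\<close>
  periods determine it up to \<open>2/m\<close> and depend continuously on \<open>\<rho>\<close>.  Two linear
  configurations of different slopes are at infinite distance in the supremum norm, so this
  continuity is proved with the weight \<open>2\<^bsup>\<bar>k\<bar>\<^esup>\<close> (\<open>growth_rate_exists\<close>); initial distance 0 in
  that estimate is the comparison principle.  Uniqueness of \<open>v\<close> needs a solution for each \<open>\<rho>\<close>.
  A contraction gives one for the system in which \<open>g\<close> is made constant outside
  \<open>[-\<bar>\<rho>\<bar> - 1, \<bar>\<rho>\<bar> + 1]\<close>, and by \<open>linear_spacing\<close> its solution never leaves the region where
  \<open>g\<close> is unchanged.
\<close>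

section \<open>Two estimates for differential inequalities\<close>

text \<open>
  A continuous function that cannot increase while it is above \<open>c\<close> never crosses \<open>c\<close>: after
  the last time at which its value is at most \<open>c\<close>, it is the integral of a nonpositive function.
  Finitely many times are exempt because the coefficients of the equations may jump.
\<close>

lemma barrier:
  fixes f f' :: "real \<Rightarrow> real"
  assumes cont: "continuous_on {a..b} f" and fin: "finite P" and start: "f a \<le> c"
    and deriv: "\<And>t. t \<in> {a<..<b} - P \<Longrightarrow> (f has_real_derivative f' t) (at t)"
    and decr: "\<And>t. t \<in> {a<..<b} - P \<Longrightarrow> c < f t \<Longrightarrow> f' t \<le> 0"
    and t: "t \<in> {a..b}"
  shows "f t \<le> c"
proof (rule ccontr)
  assume "\<not> f t \<le> c"
  then have gt: "c < f t" by simp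
  define Z where "Z = {a..t} \<inter> f -` {..c}"
  have "closed Z" unfolding Z_def
    by (rule continuous_closed_preimage) (use t in \<open>auto intro: continuous_on_subset[OF cont]\<close>)
  moreover have "bounded Z" unfolding Z_def by (intro bounded_Int) auto
  ultimately have "compact Z" by (simp add: compact_eq_bounded_closed)
  moreover have "a \<in> Z" using start t by (auto simp: Z_def)
  ultimately obtain s where s: "s \<in> Z" "\<And>r. r \<in> Z \<Longrightarrow> r \<le> s"
    using compact_attains_sup[of Z] by blast
  then have "a \<le> s" "s \<le> t" "f s \<le> c" by (auto simp: Z_def)
  have above: "c < f r" if "s < r" "r \<le> t" for r
    using s(2)[of r] that \<open>a \<le> s\<close> by (force simp: Z_def)
  define g where "g r = (if r \<in> {s<..<t} - P then f' r else 0)" for r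
  have "(g has_integral (f t - f s)) {s..t}"
  proof (rule fundamental_theorem_of_calculus_interior_strong[OF fin \<open>s \<le> t\<close>])
    fix r assume r: "r \<in> {s<..<t} - P"
    then have "r \<in> {a<..<b} - P" using \<open>a \<le> s\<close> t by auto
    with r show "(f has_vector_derivative g r) (at r)"
      by (auto simp: g_def has_real_derivative_iff_has_vector_derivative[symmetric] intro!: deriv)
  qed (use \<open>a \<le> s\<close> t in \<open>auto intro: continuous_on_subset[OF cont]\<close>)
  moreover have "g r \<le> 0" for r
    using above[of r] decr[of r] \<open>a \<le> s\<close> t by (auto simp: g_def)
  ultimately have "f t - f s \<le> 0"
    using has_integral_le[OF _ has_integral_0, of g "f t - f s" "{s..t}"] by simp
  with \<open>f s \<le> c\<close> gt show False by simp
qed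

text \<open>
  A maximum principle for infinitely many functions, whose supremum need not be attained.  Let
  \<open>E\<close> be the supremum over all times and indices, and suppose \<open>E > c\<close>.  The inequality with
  \<open>D = E\<close> says that no function grows while it is above \<open>E / 2\<close>.  So all of them stay
  below \<open>max c (E / 2)\<close>, which is less than their supremum.
\<close>

lemma sup_stays_below:
  fixes e e' :: "real \<Rightarrow> 'i \<Rightarrow> real"
  assumes cont: "\<And>k. continuous_on {a..b} (\<lambda>t. e t k)" and fin: "finite P"
    and start: "\<And>k. e a k \<le> c" and c: "0 \<le> c" and A: "0 \<le> A"
    and bdd: "\<And>t k. t \<in> {a..b} \<Longrightarrow> e t k \<le> B"
    and deriv: "\<And>t k. t \<in> {a<..<b} - P \<Longrightarrow> ((\<lambda>s. e s k) has_real_derivative e' t k) (at t)"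
    and ineq: "\<And>t k D. t \<in> {a<..<b} - P \<Longrightarrow> (\<And>j. e t j \<le> D) \<Longrightarrow> 0 < e t k
                 \<Longrightarrow> e' t k \<le> A * D - 2 * A * e t k"
    and t: "t \<in> {a..b}"
  shows "e t k \<le> c"
proof -
  define X where "X = (\<lambda>(t, k). e t k) ` ({a..b} \<times> UNIV)"
  have "X \<noteq> {}" using t by (auto simp: X_def)
  have bX: "bdd_above X" using bdd by (auto simp: X_def intro!: bdd_aboveI[of _ B])
  define E where "E = Sup X"
  have le_E: "e s j \<le> E" if "s \<in> {a..b}" for s j
    unfolding E_def using that by (intro cSup_upper[OF _ bX]) (force simp: X_def)
  have "E \<le> c"
  proof (rule ccontr)
    assume "\<not> E \<le> c"
    then have "c < E" "0 < E" using c by auto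
    have "e s j \<le> max c (E / 2)" if "s \<in> {a..b}" for s j
    proof (rule barrier[where f' = "\<lambda>t. e' t j", OF cont[of j] fin _ deriv _ that])
      fix r assume r: "r \<in> {a<..<b} - P" and gt: "max c (E / 2) < e r j"
      then have "E / 2 < e r j" by simp
      have "e' r j \<le> A * E - 2 * A * e r j"
        using r \<open>E / 2 < e r j\<close> \<open>0 < E\<close> by (intro ineq le_E) auto
      also have "\<dots> = 2 * A * (E / 2 - e r j)" by (simp add: algebra_simps)
      also have "\<dots> \<le> 0" using A \<open>E / 2 < e r j\<close> by (intro mult_nonneg_nonpos) auto
      finally show "e' r j \<le> 0" .
    qed (use start[of j] in auto)
    then have "E \<le> max c (E / 2)"
      unfolding E_def using \<open>X \<noteq> {}\<close> by (intro cSup_least) (auto simp: X_def)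
    with \<open>c < E\<close> \<open>0 < E\<close> show False by auto
  qed
  with le_E[OF t] show ?thesis by (rule order_trans)
qed

section \<open>Sequences that are additive up to a constant\<close>

lemma eq_if_bounded_multiples:
  fixes x y :: real
  assumes "\<And>m::nat. 1 \<le> m \<Longrightarrow> \<bar>real m * x - real m * y\<bar> \<le> c"
  shows "x = y"
proof (rule ccontr)
  assume "x \<noteq> y"
  then obtain m :: nat where m: "c / \<bar>x - y\<bar> < real m" using reals_Archimedean2 by blast
  then have "c < real m * \<bar>x - y\<bar>" using \<open>x \<noteq> y\<close> by (simp add: field_simps)
  also have "\<dots> \<le> real (Suc m) * \<bar>x - y\<bar>" by (intro mult_right_mono) auto
  also have "\<dots> = \<bar>real (Suc m) * x - real (Suc m) * y\<bar>"
    by (simp only: right_diff_distrib[symmetric] abs_mult abs_of_nat)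
  finally show False using assms[of "Suc m"] by simp
qed

text \<open>
  Both \<open>l a\<^sub>m\<close> and \<open>m a\<^sub>l\<close> are close to \<open>a\<^sub>m\<^sub>l\<close>, and it follows that every lower bound
  \<open>(a\<^sub>m - c) / m\<close> for the slope is at most every upper bound \<open>(a\<^sub>l + c) / l\<close>.  Any \<open>v\<close>
  between the two families will do.
\<close>

lemma quasi_additive_imp_near_linear:
  fixes a :: "nat \<Rightarrow> real"
  assumes qa: "\<And>m l. \<bar>a (m + l) - a m - a l\<bar> \<le> c"
  obtains v where "\<And>m. \<bar>a m - real m * v\<bar> \<le> c"
proof -
  have mult: "\<bar>a (Suc l * m) - real (Suc l) * a m\<bar> \<le> real l * c" for l m
  proof (induction l)
    case (Suc l)
    have "Suc (Suc l) * m = Suc l * m + m" by simp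
    then show ?case using Suc qa[of "Suc l * m" m] by (simp add: algebra_simps abs_le_iff)
  qed simp
  have "0 \<le> c" using qa[of 0 0] by linarith
  have cross: "(a m - c) / real m \<le> (a l + c) / real l" if "m \<ge> 1" "l \<ge> 1" for m l
  proof -
    obtain m' where "m = Suc m'" using \<open>m \<ge> 1\<close> by (cases m) auto
    moreover obtain l' where "l = Suc l'" using \<open>l \<ge> 1\<close> by (cases l) auto
    ultimately have eq: "m = Suc m'" "l = Suc l'" .
    have "\<bar>a (l * m) - real l * a m\<bar> \<le> real l' * c" using mult[of l' m] by (simp only: eq(2))
    moreover have "\<bar>a (l * m) - real m * a l\<bar> \<le> real m' * c"
      using mult[of m' l] by (simp only: eq(1) mult.commute[of l])
    ultimately have "real l * a m - real m * a l \<le> real l' * c + real m' * c" by linarith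
    also have "\<dots> \<le> (real m + real l) * c"
      using \<open>0 \<le> c\<close> by (simp add: eq algebra_simps)
    finally show ?thesis using that by (simp add: field_simps)
  qed
  define v where "v = (SUP m\<in>{1..}. (a m - c) / real m)"
  have "\<bar>a m - real m * v\<bar> \<le> c" for m
  proof (cases m)
    case 0
    then show ?thesis using qa[of 0 0] by simp
  next
    case (Suc m')
    then have "m \<ge> 1" by simp
    have "(a m - c) / real m \<le> v" unfolding v_def
      by (rule cSUP_upper) (use \<open>m \<ge> 1\<close> cross[of _ m] in \<open>auto intro!: bdd_aboveI2\<close>)
    moreover have "v \<le> (a m + c) / real m" unfolding v_def
      using cross \<open>m \<ge> 1\<close> by (intro cSUP_least) auto
    ultimately show ?thesis using \<open>m \<ge> 1\<close> by (simp add: field_simps abs_le_iff)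
  qed
  then show thesis by (rule that)
qed

section \<open>Solutions of bounded Lipschitz systems with infinitely many unknowns\<close>

lemma continuous_on_times_discrete:
  fixes f :: "'a::topological_space \<times> 'b discrete \<Rightarrow> 'c::topological_space"
  assumes "\<And>k. continuous_on UNIV (\<lambda>t. f (t, k))"
  shows "continuous_on UNIV f"
proof -
  have "continuous_on (\<Union>k. UNIV \<times> {k}) f"
  proof (rule continuous_on_open_UN)
    fix k :: "'b discrete"
    have "continuous_on (UNIV \<times> {k}) (\<lambda>x. f (fst x, k))"
      by (rule continuous_on_compose2[OF assms]) (auto intro: continuous_intros)
    then show "continuous_on (UNIV \<times> {k}) f"
      by (rule continuous_on_eq) auto
  qed (auto intro: open_Times open_discrete)
  also have "(\<Union>k::'b discrete. UNIV \<times> {k}) = (UNIV :: ('a \<times> 'b discrete) set)" by auto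
  finally show ?thesis .
qed

text \<open>
  The unknown is \<open>y(t, j) = exp(-l (t - t0)) (u\<^sub>j(t) - u0\<^sub>j)\<close>, a bounded continuous function
  of a real time and a discrete index.  With the exponential weight the integral operator is a
  contraction for all times at once, so that no gluing of short time intervals is needed.  The
  boundedness of \<open>F\<close> makes the operator map into bounded functions; \<open>u0\<close> itself may be unbounded.
\<close>

lemma picard_lattice:
  fixes F :: "real \<Rightarrow> ('i \<Rightarrow> real) \<Rightarrow> 'i \<Rightarrow> real"
  assumes bound: "\<And>t u k. \<bar>F t u k\<bar> \<le> M"
    and lip: "\<And>t u w k D. (\<And>j. \<bar>u j - w j\<bar> \<le> D) \<Longrightarrow> \<bar>F t u k - F t w k\<bar> \<le> L * D"
    and L: "0 \<le> L" and N: "countable N"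
    and cont: "\<And>u k t. (\<And>j. isCont (\<lambda>s. u s j) t) \<Longrightarrow> t \<notin> N \<Longrightarrow> isCont (\<lambda>s. F s (u s) k) t"
  obtains u where "\<And>k. u t0 k = u0 k" "\<And>k. continuous_on UNIV (\<lambda>t. u t k)"
    "\<And>t k. t0 \<le> t \<Longrightarrow> t \<notin> N \<Longrightarrow> ((\<lambda>s. u s k) has_real_derivative F t (u t) k) (at t within {t0..})"
    "\<And>t k. t0 \<le> t \<Longrightarrow> \<bar>u t k - u0 k\<bar> \<le> M * (t - t0)"
proof -
  define l where "l = 2 * L + 1"
  have l: "0 < l" using L by (simp add: l_def)
  have M: "0 \<le> M" using bound[of undefined undefined undefined] by linarith
  define cfg where "cfg y t j = u0 j + exp (l * (t - t0)) * apply_bcontfun y (t, discrete j)"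
    for y :: "(real \<times> 'i discrete) \<Rightarrow>\<^sub>C real" and t and j
  define rhs where "rhs y k t = F t (cfg y t) k" for y k t
  have y_cont: "continuous_on UNIV (\<lambda>t. apply_bcontfun y (t, j))"
    for y :: "(real \<times> 'i discrete) \<Rightarrow>\<^sub>C real" and j
    by (rule continuous_on_compose2[OF continuous_on_apply_bcontfun[of UNIV]])
      (auto intro!: continuous_intros)
  have cfg_cont: "continuous_on UNIV (\<lambda>t. cfg y t j)" for y j
    unfolding cfg_def by (intro continuous_intros y_cont)
  have rhs_cont: "isCont (rhs y k) t" if "t \<notin> N" for y k t
    unfolding rhs_def by (rule cont[OF _ that]) (use cfg_cont in \<open>simp add: continuous_on_eq_continuous_at\<close>)
  have rhs_int: "rhs y k integrable_on {a..b}" for y k a b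
  proof (rule measurable_bounded_by_integrable_imp_integrable_real)
    have "rhs y k \<in> borel_measurable borel"
      by (rule borel_measurable_continuous_countable_exceptions[OF N])
        (auto intro!: continuous_at_imp_continuous_on rhs_cont)
    then show "rhs y k \<in> borel_measurable (lebesgue_on {a..b})"
      by (simp add: measurable_completion measurable_restrict_space1)
    show "(\<lambda>_. M) integrable_on {a..b}" by (rule integrable_const_ivl)
  qed (auto simp: rhs_def bound)
  \<comment> \<open>Times before \<open>t0\<close> are frozen at \<open>t0\<close>, which keeps the domain all of the real line.\<close>
  define Phi where "Phi y = (\<lambda>(t, k). exp (- l * (max t0 t - t0)) * integral {t0..max t0 t} (rhs y (of_discrete k)))"
    for y
  have Phi_cont: "continuous_on UNIV (\<lambda>t. integral {t0..max t0 t} (rhs y k))" for y k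
  proof (rule continuous_at_imp_continuous_on, rule ballI)
    fix s :: real
    have "continuous_on {..s+1} (\<lambda>t. integral {t0..max t0 t} (rhs y k))"
      by (rule continuous_on_compose2[OF indefinite_integral_continuous_1[OF rhs_int[of y k t0 "max t0 (s+1)"]]])
        (auto intro!: continuous_intros)
    then show "isCont (\<lambda>t. integral {t0..max t0 t} (rhs y k)) s"
      by (rule continuous_on_interior) simp
  qed
  have int_bound: "\<bar>integral {t0..t} (rhs y k)\<bar> \<le> M * (t - t0)" if "t0 \<le> t" for y k t
    using integral_norm_bound_integral[OF rhs_int integrable_const_ivl, of t0 t y k M] that
    by (simp add: rhs_def bound mult.commute)
  \<comment> \<open>The weight also makes the linearly growing integral of a bounded function bounded.\<close>
  have decay: "exp (- l * r) * r \<le> 1 / l" if "0 \<le> r" for r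
  proof -
    have "l * r \<le> exp (l * r)" using exp_ge_add_one_self[of "l * r"] by linarith
    then show ?thesis using l by (simp add: exp_minus field_simps)
  qed
  have Phi_mem: "Phi y \<in> bcontfun" for y
  proof (rule bcontfun_normI[where b = "M / l"])
    show "continuous_on UNIV (Phi y)"
      by (rule continuous_on_times_discrete)
        (auto simp: Phi_def intro!: continuous_intros Phi_cont)
    fix x :: "real \<times> 'i discrete"
    obtain t k where x: "x = (t, discrete k)" by (metis of_discrete_inverse surj_pair)
    have "norm (integral {t0..max t0 t} (rhs y k)) \<le> M * (max t0 t - t0)"
      using int_bound[of "max t0 t"] by simp
    then have "norm (Phi y x) \<le> exp (- l * (max t0 t - t0)) * (M * (max t0 t - t0))"
      by (simp add: Phi_def x discrete_inverse abs_mult)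
    also have "\<dots> = M * (exp (- l * (max t0 t - t0)) * (max t0 t - t0))" by simp
    also have "\<dots> \<le> M * (1 / l)" by (intro mult_left_mono decay M) auto
    finally show "norm (Phi y x) \<le> M / l" by simp
  qed
  have Phi_apply: "apply_bcontfun (Bcontfun (Phi y)) = Phi y" for y
    by (rule Bcontfun_inverse[OF Phi_mem])
  have "\<forall>y z. dist (Bcontfun (Phi y)) (Bcontfun (Phi z)) \<le> 1 / 2 * dist y z"
  proof (intro allI dist_bound)
    fix y z :: "(real \<times> 'i discrete) \<Rightarrow>\<^sub>C real" and x :: "real \<times> 'i discrete"
    obtain t k where x: "x = (t, discrete k)" by (metis of_discrete_inverse surj_pair)
    let ?s = "max t0 t" and ?d = "dist y z"
    have diff: "norm (rhs y k r - rhs z k r) \<le> L * ?d * exp (l * (r - t0))" for r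
    proof -
      have "\<bar>cfg y r j - cfg z r j\<bar> \<le> exp (l * (r - t0)) * ?d" for j
      proof -
        have "\<bar>cfg y r j - cfg z r j\<bar> =
            exp (l * (r - t0)) * dist (apply_bcontfun y (r, discrete j)) (apply_bcontfun z (r, discrete j))"
          by (simp add: cfg_def dist_real_def abs_mult right_diff_distrib[symmetric])
        also have "\<dots> \<le> exp (l * (r - t0)) * ?d"
          by (intro mult_left_mono dist_bounded) auto
        finally show ?thesis .
      qed
      from lip[OF this] show ?thesis by (simp add: rhs_def mult_ac)
    qed
    have expint: "((\<lambda>r. exp (l * (r - t0))) has_integral
        (exp (l * (?s - t0)) / l - exp (l * (t0 - t0)) / l)) {t0..?s}"
      by (rule fundamental_theorem_of_calculus)
        (use l in \<open>auto intro!: derivative_eq_intros simp: has_real_derivative_iff_has_vector_derivative[symmetric]\<close>)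
    have "norm (integral {t0..?s} (rhs y k) - integral {t0..?s} (rhs z k))
          = norm (integral {t0..?s} (\<lambda>r. rhs y k r - rhs z k r))"
      by (simp add: Henstock_Kurzweil_Integration.integral_diff rhs_int)
    also have "\<dots> \<le> integral {t0..?s} (\<lambda>r. L * ?d * exp (l * (r - t0)))"
      using diff
      by (intro integral_norm_bound_integral Henstock_Kurzweil_Integration.integrable_diff rhs_int
            integrable_on_mult_right has_integral_integrable[OF expint]) auto
    also have "\<dots> = L * ?d * ((exp (l * (?s - t0)) - 1) / l)"
      using integral_unique[OF expint] by (simp add: diff_divide_distrib)
    also have "\<dots> \<le> L * ?d * (exp (l * (?s - t0)) / l)"
      using l L by (intro mult_left_mono divide_right_mono) auto
    finally have "exp (- l * (?s - t0)) * norm (integral {t0..?s} (rhs y k) - integral {t0..?s} (rhs z k))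
       \<le> exp (- l * (?s - t0)) * (L * ?d * (exp (l * (?s - t0)) / l))"
      by (intro mult_left_mono) auto
    also have "\<dots> = exp (- l * (?s - t0)) * exp (l * (?s - t0)) * (L / l * ?d)"
      by (simp add: mult_ac)
    also have "exp (- l * (?s - t0)) * exp (l * (?s - t0)) = 1"
      by (simp add: exp_add[symmetric])
    also have "1 * (L / l * ?d) = L / l * ?d" by simp
    also have "\<dots> \<le> 1 / 2 * ?d"
      using l L by (intro mult_right_mono) (auto simp: l_def field_simps)
    finally show "dist (apply_bcontfun (Bcontfun (Phi y)) x) (apply_bcontfun (Bcontfun (Phi z)) x) \<le> 1 / 2 * ?d"
      unfolding Phi_apply by (simp add: Phi_def x discrete_inverse dist_real_def right_diff_distrib[symmetric] abs_mult)
  qed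
  then obtain y where fixed: "Bcontfun (Phi y) = y"
    using banach_fix_type[of "1/2" "\<lambda>y. Bcontfun (Phi y)"] by auto
  have u_eq: "cfg y t k = u0 k + integral {t0..t} (rhs y k)" if "t0 \<le> t" for t k
  proof -
    have "apply_bcontfun y (t, discrete k) = Phi y (t, discrete k)" using Phi_apply[of y] fixed by simp
    with that show ?thesis by (simp add: cfg_def Phi_def exp_minus discrete_inverse)
  qed
  show thesis
  proof (rule that)
    show "cfg y t0 k = u0 k" for k by (simp add: u_eq)
    show "continuous_on UNIV (\<lambda>t. cfg y t k)" for k by (rule cfg_cont)
    show "\<bar>cfg y t k - u0 k\<bar> \<le> M * (t - t0)" if "t0 \<le> t" for t k
      using int_bound[OF that] that by (simp add: u_eq)
    fix t k assume t: "t0 \<le> t" "t \<notin> N"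
    have "((\<lambda>s. integral {t0..s} (rhs y k)) has_vector_derivative rhs y k t) (at t within {t0..t+1} - {})"
      by (rule integral_has_vector_derivative_continuous_at[OF rhs_int])
        (use t rhs_cont[of t y k] in \<open>auto intro: continuous_at_imp_continuous_at_within\<close>)
    then have "((\<lambda>s. u0 k + integral {t0..s} (rhs y k)) has_real_derivative rhs y k t) (at t within {t0..t+1})"
      by (auto simp: has_real_derivative_iff_has_vector_derivative intro!: derivative_eq_intros)
    then have "((\<lambda>s. cfg y s k) has_real_derivative rhs y k t) (at t within {t0..t+1})"
      by (rule has_field_derivative_transform_within[where d = 1]) (use t in \<open>auto simp: u_eq\<close>)
    moreover have "at t within {t0..t+1} = at t within {t0..}"
      by (rule at_within_nhd[of _ "{..<t+1}"]) (use t in auto)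
    ultimately show "((\<lambda>s. cfg y s k) has_real_derivative F t (cfg y t) k) (at t within {t0..})"
      by (simp add: rhs_def)
  qed
qed

section \<open>Monotone lattice systems\<close>

lemma periodic_lipschitz_bounded:
  fixes f :: "real \<Rightarrow> real"
  assumes "C-lipschitz_on UNIV f" and per: "\<And>x. f (x + 1) = f x"
  shows "\<bar>f x\<bar> \<le> \<bar>f 0\<bar> + C"
proof -
  interpret periodic_fun_simple' f by standard (rule per)
  have "f x = f (frac x)" using plus_of_int[of "frac x" "\<lfloor>x\<rfloor>"] by (simp add: frac_def)
  moreover have "dist (f (frac x)) (f 0) \<le> C * dist (frac x) 0"
    using assms(1) by (rule lipschitz_onD) auto
  moreover have "\<dots> \<le> C * 1"
    using lipschitz_on_nonneg[OF assms(1)] frac_lt_1[of x] frac_ge_0[of x]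
    by (intro mult_left_mono) (auto simp: dist_real_def)
  ultimately show ?thesis by (auto simp: dist_real_def)
qed

text \<open>
  The common form of (R1), where \<open>p = 1\<close> and \<open>q = K\<close>, and (R2), where \<open>p = K\<close> and \<open>q = 1\<close>.
  \<open>N\<close> contains the jump times of the coefficients.  \<open>g\<close> is only locally Lipschitz: \<open>W''\<close> may be
  unbounded.
\<close>

locale lattice_chain =
  fixes g h p q :: "real \<Rightarrow> real" and N :: "real set"
  assumes mono_g: "mono g"
    and lipschitz_g: "\<And>R. \<exists>L. L-lipschitz_on {-R..R} g"
    and lipschitz_h: "\<exists>C. C-lipschitz_on UNIV h"
    and periodic_h: "\<And>x. h (x + 1) = h x"
    and p_nonneg: "\<And>t. 0 \<le> p t" and bounded_p: "bounded (range p)" and bounded_q: "bounded (range q)"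
    and finite_N: "\<And>a b. finite (N \<inter> {a..b})"
    and cont_p: "\<And>t. t \<notin> N \<Longrightarrow> isCont p t" and cont_q: "\<And>t. t \<notin> N \<Longrightarrow> isCont q t"
begin

definition field :: "real \<Rightarrow> (int \<Rightarrow> real) \<Rightarrow> int \<Rightarrow> real" where
  "field t u k = p t * (g (u (k + 1) - u k) - g (u k - u (k - 1))) + q t * h (u k)"

definition sol :: "real \<Rightarrow> (real \<Rightarrow> int \<Rightarrow> real) \<Rightarrow> bool" where
  "sol t0 u \<longleftrightarrow>
     (\<forall>b. \<exists>B. \<forall>t\<in>{t0..b}. \<forall>k. \<bar>u t (k + 1) - u t k\<bar> \<le> B) \<and>
     (\<forall>k. continuous_on {t0..} (\<lambda>t. u t k)) \<and>
     (\<forall>t\<ge>t0. t \<notin> N \<longrightarrow>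
        (\<forall>k. ((\<lambda>s. u s k) has_real_derivative field t (u t) k) (at t within {t0..})))"

lemma sol_spacing: "sol t0 u \<Longrightarrow> \<exists>B. \<forall>t\<in>{t0..b}. \<forall>k. \<bar>u t (k + 1) - u t k\<bar> \<le> B"
  by (auto simp: sol_def)

lemma sol_continuous: "sol t0 u \<Longrightarrow> continuous_on {t0..} (\<lambda>t. u t k)"
  by (auto simp: sol_def)

lemma sol_deriv:
  assumes "sol t0 u" "t0 < t" "t \<notin> N"
  shows "((\<lambda>s. u s k) has_real_derivative field t (u t) k) (at t)"
proof -
  have "((\<lambda>s. u s k) has_real_derivative field t (u t) k) (at t within {t0..})"
    using assms by (auto simp: sol_def)
  moreover have "at t within {t0..} = at t"
    using assms by (intro at_within_interior) auto
  ultimately show ?thesis by simp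
qed

lemma sol_later:
  assumes "sol t0 u" "t0 \<le> t1"
  shows "sol t1 u"
  unfolding sol_def
proof (intro conjI allI impI)
  fix b show "\<exists>B. \<forall>t\<in>{t1..b}. \<forall>k. \<bar>u t (k + 1) - u t k\<bar> \<le> B"
    using sol_spacing[OF assms(1), of b] assms(2) by (meson atLeastAtMost_iff order_trans)
next
  fix k show "continuous_on {t1..} (\<lambda>t. u t k)"
    using sol_continuous[OF assms(1)] assms(2) by (auto intro: continuous_on_subset)
next
  fix t k assume "t1 \<le> t" "t \<notin> N"
  then have "((\<lambda>s. u s k) has_real_derivative field t (u t) k) (at t within {t0..})"
    using assms by (auto simp: sol_def)
  then show "((\<lambda>s. u s k) has_real_derivative field t (u t) k) (at t within {t1..})"
    by (rule DERIV_subset) (use assms in auto)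
qed

lemma periodic_h_int: "h (x + of_int i) = h x"
proof -
  interpret periodic_fun_simple' h by standard (rule periodic_h)
  show ?thesis by (rule plus_of_int)
qed

lemma sol_symmetry:
  assumes u: "sol t0 u"
  shows "sol t0 (\<lambda>t k. u t (k + j) + of_int i)"
  unfolding sol_def
proof (intro conjI allI impI)
  have field: "field t (\<lambda>k. v (k + j) + of_int i) k = field t v (k + j)" for t v k
    unfolding field_def periodic_h_int by (simp add: algebra_simps)
  fix b
  obtain B where B: "\<forall>t\<in>{t0..b}. \<forall>k. \<bar>u t (k + 1) - u t k\<bar> \<le> B"
    using sol_spacing[OF u, of b] by blast
  have "\<bar>u t (k + 1 + j) + of_int i - (u t (k + j) + of_int i)\<bar> \<le> B" if "t \<in> {t0..b}" for t k
    using B[rule_format, OF that, of "k + j"] by (simp add: ac_simps)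
  then show "\<exists>B. \<forall>t\<in>{t0..b}. \<forall>k. \<bar>u t (k + 1 + j) + of_int i - (u t (k + j) + of_int i)\<bar> \<le> B"
    by blast
  fix k
  show "continuous_on {t0..} (\<lambda>t. u t (k + j) + of_int i)"
    by (intro continuous_intros sol_continuous[OF u])
  fix t assume "t0 \<le> t" "t \<notin> N"
  then have "((\<lambda>s. u s (k + j)) has_real_derivative field t (u t) (k + j)) (at t within {t0..})"
    using u by (simp add: sol_def)
  then show "((\<lambda>s. u s (k + j) + of_int i) has_real_derivative field t (\<lambda>k. u t (k + j) + of_int i) k)
      (at t within {t0..})"
    unfolding field by (intro DERIV_add[where E = 0, simplified] DERIV_const)
qed

lemma coefficient_bounds:
  obtains P Q where "0 \<le> P" "\<And>t. p t \<le> P" "0 \<le> Q" "\<And>t. \<bar>q t\<bar> \<le> Q"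
proof -
  obtain P Q where "\<And>t. \<bar>p t\<bar> \<le> P" "\<And>t. \<bar>q t\<bar> \<le> Q"
    using bounded_p bounded_q by (auto simp: bounded_iff)
  then show thesis
    by (intro that[of P Q]) (auto intro: order_trans[OF abs_ge_self] order_trans[OF abs_ge_zero])
qed

lemma field_bounded:
  obtains M where "\<And>t u k. g (u (k + 1) - u k) \<in> {a..b} \<Longrightarrow> g (u k - u (k - 1)) \<in> {a..b}
    \<Longrightarrow> \<bar>field t u k\<bar> \<le> M"
proof -
  obtain P Q where PQ: "0 \<le> P" "\<And>t. p t \<le> P" "0 \<le> Q" "\<And>t. \<bar>q t\<bar> \<le> Q"
    using coefficient_bounds by blast
  obtain C where C: "C-lipschitz_on UNIV h" using lipschitz_h by blast
  have h: "\<bar>h x\<bar> \<le> \<bar>h 0\<bar> + C" for x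
    using C periodic_h by (rule periodic_lipschitz_bounded)
  have "\<bar>field t u k\<bar> \<le> P * (b - a) + Q * (\<bar>h 0\<bar> + C)"
    if "g (u (k + 1) - u k) \<in> {a..b}" "g (u k - u (k - 1)) \<in> {a..b}" for t u k
  proof -
    have "\<bar>g (u (k + 1) - u k) - g (u k - u (k - 1))\<bar> \<le> b - a" using that by auto
    then have "p t * \<bar>g (u (k + 1) - u k) - g (u k - u (k - 1))\<bar> \<le> P * (b - a)"
      using PQ p_nonneg by (intro mult_mono) auto
    moreover have "\<bar>q t\<bar> * \<bar>h (u k)\<bar> \<le> Q * (\<bar>h 0\<bar> + C)"
      using PQ h by (intro mult_mono) auto
    ultimately show ?thesis
      unfolding field_def using p_nonneg[of t]
      by (intro order_trans[OF abs_triangle_ineq]) (auto simp: abs_mult)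
  qed
  then show thesis by (rule that)
qed

lemma field_bounded_spacing:
  obtains M where "\<And>t u k. \<forall>j. \<bar>u (j + 1) - u j\<bar> \<le> R \<Longrightarrow> \<bar>field t u k\<bar> \<le> M"
proof -
  obtain M where M: "\<And>t u k. g (u (k + 1) - u k) \<in> {g (- R)..g R} \<Longrightarrow>
      g (u k - u (k - 1)) \<in> {g (- R)..g R} \<Longrightarrow> \<bar>field t u k\<bar> \<le> M"
    using field_bounded[of "g (- R)" "g R"] by blast
  have "\<bar>field t u k\<bar> \<le> M" if R: "\<forall>j. \<bar>u (j + 1) - u j\<bar> \<le> R" for t u k
  proof (rule M)
    show "g (u (k + 1) - u k) \<in> {g (- R)..g R}" "g (u k - u (k - 1)) \<in> {g (- R)..g R}"
      using R[rule_format, of k] R[rule_format, of "k - 1"]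
      by (auto simp: abs_le_iff intro!: monoD[OF mono_g])
  qed
  then show thesis by (rule that)
qed

text \<open>
  This turns bounds on the velocity into bounds that are uniform in \<open>k\<close>, which the maximum
  principle needs in advance.
\<close>

lemma drift_bound:
  assumes u: "sol t0 u" and M: "\<And>t k. t \<in> {t0..t1} \<Longrightarrow> \<bar>field t (u t) k\<bar> \<le> M"
    and t: "t \<in> {t0..t1}"
  shows "\<bar>u t k - u t0 k\<bar> \<le> M * (t - t0)"
proof -
  have "\<sigma> * (u t k - u t0 k) - M * (t - t0) \<le> 0" if \<sigma>: "\<bar>\<sigma>\<bar> = 1" for \<sigma> :: real
  proof (rule barrier[where f = "\<lambda>s. \<sigma> * (u s k - u t0 k) - M * (s - t0)"
        and f' = "\<lambda>s. \<sigma> * field s (u s) k - M" and a = t0 and b = t1 and P = "N \<inter> {t0..t1}", OF _ finite_N])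
    show "continuous_on {t0..t1} (\<lambda>s. \<sigma> * (u s k - u t0 k) - M * (s - t0))"
      by (intro continuous_intros continuous_on_subset[OF sol_continuous[OF u]]) auto
    fix s assume s: "s \<in> {t0<..<t1} - N \<inter> {t0..t1}"
    show "((\<lambda>s. \<sigma> * (u s k - u t0 k) - M * (s - t0)) has_real_derivative \<sigma> * field s (u s) k - M) (at s)"
      using s by (auto intro!: derivative_eq_intros sol_deriv[OF u])
    have "\<sigma> * field s (u s) k \<le> \<bar>\<sigma> * field s (u s) k\<bar>" by simp
    also have "\<dots> \<le> M" using M[of s k] s \<sigma> by (simp add: abs_mult)
    finally show "\<sigma> * field s (u s) k - M \<le> 0" by simp
  qed (use t in auto)
  from this[of 1] this[of "-1"] show ?thesis by (simp add: abs_le_iff)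
qed

section \<open>Continuous dependence and comparison\<close>

text \<open>
  The weight dominates \<open>\<bar>k\<bar>\<close>, hence the difference of two linear configurations, and it
  changes by at most a constant factor between neighbours, which the coupling requires.
\<close>

definition weight :: "int \<Rightarrow> real" where "weight k = 2 ^ nat \<bar>k\<bar>"

lemma weight_ge_1: "1 \<le> weight k" and weight_pos: "0 < weight k"
  by (auto simp: weight_def)

lemma abs_le_weight: "\<bar>of_int k\<bar> \<le> weight k"
proof -
  have "real (nat \<bar>k\<bar>) \<le> 2 ^ nat \<bar>k\<bar>"
    using of_nat_less_two_power[of "nat \<bar>k\<bar>", where ?'a = real] by (rule less_imp_le)
  then show ?thesis by (simp add: weight_def)
qed

lemma weight_neighbours: "weight (k + 1) \<le> 2 * weight k" "weight (k - 1) \<le> 2 * weight k"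
proof -
  have "weight j \<le> 2 * weight k" if "\<bar>j\<bar> \<le> \<bar>k\<bar> + 1" for j
  proof -
    have "weight j \<le> 2 ^ Suc (nat \<bar>k\<bar>)"
      unfolding weight_def using that by (intro power_increasing) auto
    then show ?thesis by (simp add: weight_def)
  qed
  then show "weight (k + 1) \<le> 2 * weight k" "weight (k - 1) \<le> 2 * weight k" by auto
qed

lemma mono_lipschitz_le:
  assumes "L-lipschitz_on {-R..R} g" "x \<in> {-R..R}" "y \<in> {-R..R}" "x - y \<le> z" "0 \<le> z"
  shows "g x - g y \<le> L * z"
proof (cases "y \<le> x")
  case True
  have "g x - g y \<le> dist (g x) (g y)" by (simp add: dist_real_def)
  also have "\<dots> \<le> L * dist x y" using assms by (intro lipschitz_onD)
  also have "\<dots> \<le> L * z"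
    using True assms lipschitz_on_nonneg[OF assms(1)] by (intro mult_left_mono) (auto simp: dist_real_def)
  finally show ?thesis .
next
  case False
  then have "g x \<le> g y" by (intro monoD[OF mono_g]) auto
  moreover have "0 \<le> L * z" using assms lipschitz_on_nonneg[OF assms(1)] by (intro mult_nonneg_nonneg)
  ultimately show ?thesis by simp
qed

text \<open>
  Monotonicity of \<open>g\<close> makes the estimate one-sided.  Where \<open>u\<^sub>k > w\<^sub>k\<close>, the coupling to a neighbour pulls
  \<open>u\<^sub>k - w\<^sub>k\<close> up only if the neighbour's difference is larger still, and then by at most \<open>P L\<close> times
  that difference, which is at most \<open>2 D weight(k)\<close>.  So an upper bound \<open>D\<close> for the weighted
  differences suffices.
\<close>

lemma field_diff_le:
  assumes L: "L-lipschitz_on {-R..R} g" and C: "C-lipschitz_on UNIV h"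
    and P: "p t \<le> P" and Q: "\<bar>q t\<bar> \<le> Q"
    and u: "\<And>j. \<bar>u (j + 1) - u j\<bar> \<le> R" and w: "\<And>j. \<bar>w (j + 1) - w j\<bar> \<le> R"
    and D: "\<And>j. u j - w j \<le> D * weight j" and pos: "0 < u k - w k"
  shows "field t u k - field t w k \<le> 4 * P * L * (D * weight k) + Q * C * (u k - w k)"
proof -
  have D0: "0 \<le> D"
    using D[of k] pos weight_pos[of k] by (smt (verit) mult_less_0_iff)
  have nb: "u (k + 1) - w (k + 1) \<le> 2 * (D * weight k)" "u (k - 1) - w (k - 1) \<le> 2 * (D * weight k)"
    using D[of "k + 1"] D[of "k - 1"] mult_left_mono[OF weight_neighbours(1)[of k] D0]
      mult_left_mono[OF weight_neighbours(2)[of k] D0] by linarith+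
  have in_R: "v (j + 1) - v j \<in> {-R..R}" if "\<And>j. \<bar>v (j + 1) - v j\<bar> \<le> R" for v :: "int \<Rightarrow> real" and j
    using that[of j] by (simp add: abs_le_iff)
  have in_R': "v j - v (j - 1) \<in> {-R..R}" if "\<And>j. \<bar>v (j + 1) - v j\<bar> \<le> R" for v :: "int \<Rightarrow> real" and j
    using that[of "j - 1"] by (simp add: abs_le_iff)
  have z: "0 \<le> 2 * (D * weight k)" using D0 weight_pos[of k] by simp
  have "g (u (k + 1) - u k) - g (w (k + 1) - w k) \<le> L * (2 * (D * weight k))"
    using nb pos z by (intro mono_lipschitz_le[OF L] in_R u w) auto
  moreover have "g (w k - w (k - 1)) - g (u k - u (k - 1)) \<le> L * (2 * (D * weight k))"
    using nb pos z by (intro mono_lipschitz_le[OF L] in_R' u w) auto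
  ultimately have "(g (u (k + 1) - u k) - g (u k - u (k - 1))) - (g (w (k + 1) - w k) - g (w k - w (k - 1)))
      \<le> 4 * L * (D * weight k)" by simp
  then have "p t * ((g (u (k + 1) - u k) - g (u k - u (k - 1))) - (g (w (k + 1) - w k) - g (w k - w (k - 1))))
      \<le> p t * (4 * L * (D * weight k))"
    by (rule mult_left_mono) (rule p_nonneg)
  also have "\<dots> \<le> P * (4 * L * (D * weight k))"
    using P lipschitz_on_nonneg[OF L] z by (intro mult_right_mono) auto
  finally have g_part: "p t * ((g (u (k + 1) - u k) - g (u k - u (k - 1))) - (g (w (k + 1) - w k) - g (w k - w (k - 1))))
      \<le> 4 * P * L * (D * weight k)" by simp
  have "\<bar>h (u k) - h (w k)\<bar> \<le> C * (u k - w k)"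
    using lipschitz_onD[OF C, of "u k" "w k"] pos by (simp add: dist_real_def)
  then have "\<bar>q t\<bar> * \<bar>h (u k) - h (w k)\<bar> \<le> Q * (C * (u k - w k))"
    using Q by (intro mult_mono) auto
  then have "q t * (h (u k) - h (w k)) \<le> Q * C * (u k - w k)"
    by (simp add: abs_mult[symmetric] abs_le_iff)
  with g_part show ?thesis by (simp add: field_def algebra_simps)
qed

text \<open>
  The bound is one-sided: with \<open>c = 0\<close> it says that order is preserved, and applied both ways
  it says that solutions depend continuously on the initial configuration.
\<close>

definition growth_rate :: "real \<Rightarrow> real \<Rightarrow> bool" where
  "growth_rate R lam \<longleftrightarrow> (\<forall>t0 t1 u w c. sol t0 u \<longrightarrow> sol t0 w \<longrightarrow>
     (\<forall>t\<in>{t0..t1}. \<forall>k. \<bar>u t (k + 1) - u t k\<bar> \<le> R \<and> \<bar>w t (k + 1) - w t k\<bar> \<le> R) \<longrightarrow>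
     0 \<le> c \<longrightarrow> (\<forall>k. u t0 k - w t0 k \<le> c * weight k) \<longrightarrow>
     (\<forall>t\<in>{t0..t1}. \<forall>k. u t k - w t k \<le> c * weight k * exp (lam * (t - t0))))"

text \<open>
  The maximum principle applies to \<open>e\<^sub>k = (u\<^sub>k - w\<^sub>k) exp(-lam (t - t0)) / weight(k)\<close>.  Where
  \<open>e\<^sub>k > 0\<close>, \<open>field_diff_le\<close> gives \<open>e\<^sub>k' \<le> A D + Q C e\<^sub>k - lam e\<^sub>k\<close>, and \<open>lam\<close> is chosen so that the right
  side is \<open>A D - 2 A e\<^sub>k\<close>.
\<close>

lemma growth_rate_exists: "\<exists>lam. growth_rate R lam"
proof -
  obtain P Q where PQ: "0 \<le> P" "\<And>t. p t \<le> P" "0 \<le> Q" "\<And>t. \<bar>q t\<bar> \<le> Q"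
    using coefficient_bounds by blast
  obtain C where C: "C-lipschitz_on UNIV h" using lipschitz_h by blast
  obtain L where L: "L-lipschitz_on {-R..R} g" using lipschitz_g by blast
  obtain M where M: "\<And>t u k. \<forall>j. \<bar>u (j + 1) - u j\<bar> \<le> R \<Longrightarrow> \<bar>field t u k\<bar> \<le> M"
    using field_bounded_spacing[of R] by blast
  define A where "A = 4 * P * L"
  define lam where "lam = 2 * A + Q * C"
  have A: "0 \<le> A" using PQ lipschitz_on_nonneg[OF L] by (simp add: A_def)
  have lam: "0 \<le> lam" using A PQ lipschitz_on_nonneg[OF C] by (simp add: lam_def)
  have "growth_rate R lam"
    unfolding growth_rate_def
  proof (intro allI impI ballI)
    fix t0 t1 u w c t k
    assume u: "sol t0 u" and w: "sol t0 w"
      and spacing: "\<forall>t\<in>{t0..t1}. \<forall>k. \<bar>u t (k + 1) - u t k\<bar> \<le> R \<and> \<bar>w t (k + 1) - w t k\<bar> \<le> R"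
      and c: "0 \<le> c" and start: "\<forall>k. u t0 k - w t0 k \<le> c * weight k" and t: "t \<in> {t0..t1}"
    have uR: "\<bar>u t (k + 1) - u t k\<bar> \<le> R" and wR: "\<bar>w t (k + 1) - w t k\<bar> \<le> R"
      if "t \<in> {t0..t1}" for t k
      using spacing[rule_format, OF that, of k] by auto
    define E where "E s = exp (- lam * (s - t0))" for s
    define e where "e s j = (u s j - w s j) * E s / weight j" for s j
    define e' where "e' s j = (field s (u s) j - field s (w s) j) * E s / weight j - lam * e s j" for s j
    have E: "0 < E s" "E t0 = 1" for s by (auto simp: E_def)
    have E1: "E s \<le> 1" if "t0 \<le> s" for s using that lam by (simp add: E_def)
    have "\<forall>j. \<bar>u t0 (j + 1) - u t0 j\<bar> \<le> R" by (intro allI uR) (use t in simp)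
    from M[OF this, of t0 0] have M0: "0 \<le> M" by linarith
    have "e t k \<le> c"
    proof (rule sup_stays_below[where e = e and e' = e' and P = "N \<inter> {t0..t1}" and a = t0 and b = t1
          and B = "c + 2 * (M * (t1 - t0))" and A = A, OF _ finite_N _ c A _ _ _ t])
      fix j
      show "continuous_on {t0..t1} (\<lambda>t. e t j)"
        unfolding e_def E_def using weight_pos[of j]
        by (intro continuous_intros continuous_on_subset[OF sol_continuous[OF u]]
              continuous_on_subset[OF sol_continuous[OF w]]) auto
      show "e t0 j \<le> c" using start[rule_format, of j] weight_pos[of j] by (simp add: e_def E divide_le_eq)
    next
      fix s j assume s: "s \<in> {t0..t1}"
      have "\<bar>u s j - u t0 j\<bar> \<le> M * (s - t0)" "\<bar>w s j - w t0 j\<bar> \<le> M * (s - t0)"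
        by (intro drift_bound[OF u _ s] drift_bound[OF w _ s] M allI uR wR; simp)+
      then have "u s j - w s j \<le> c * weight j + 2 * (M * (s - t0))"
        using start[rule_format, of j] by linarith
      also have "\<dots> \<le> c * weight j + 2 * (M * (t1 - t0)) * weight j"
      proof -
        have "M * (s - t0) * 1 \<le> M * (t1 - t0) * weight j"
          using M0 s weight_ge_1[of j] by (intro mult_mono) auto
        then show ?thesis by simp
      qed
      finally have "u s j - w s j \<le> (c + 2 * (M * (t1 - t0))) * weight j"
        by (simp add: algebra_simps)
      then have "(u s j - w s j) / weight j \<le> c + 2 * (M * (t1 - t0))"
        using weight_pos[of j] by (simp only: pos_divide_le_eq)
      moreover have "0 \<le> c + 2 * (M * (t1 - t0))" using c M0 s by auto
      moreover have "0 \<le> E s" "E s \<le> 1" using E(1)[of s] E1[of s] s by auto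
      ultimately have "(u s j - w s j) / weight j * E s \<le> (c + 2 * (M * (t1 - t0))) * 1"
        by (meson mult_mono)
      then show "e s j \<le> c + 2 * (M * (t1 - t0))" by (simp add: e_def)
    next
      fix s j assume s: "s \<in> {t0<..<t1} - N \<inter> {t0..t1}"
      then have "t0 < s" "s \<notin> N" by auto
      have "(E has_real_derivative - lam * E s) (at s)"
        unfolding E_def by (auto intro!: derivative_eq_intros)
      from DERIV_cdivide[OF DERIV_mult'[OF DERIV_diff[OF sol_deriv[OF u \<open>t0 < s\<close> \<open>s \<notin> N\<close>, of j]
            sol_deriv[OF w \<open>t0 < s\<close> \<open>s \<notin> N\<close>, of j]] this], of "weight j"]
      show "((\<lambda>s. e s j) has_real_derivative e' s j) (at s)"
        by (simp add: e_def[abs_def] e'_def add_divide_distrib diff_divide_distrib mult_ac)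
    next
      fix s j D assume s: "s \<in> {t0<..<t1} - N \<inter> {t0..t1}" and D: "\<And>i. e s i \<le> D" and pos: "0 < e s j"
      have sR: "\<bar>u s (i + 1) - u s i\<bar> \<le> R" "\<bar>w s (i + 1) - w s i\<bar> \<le> R" for i
        using s uR wR by auto
      have "field s (u s) j - field s (w s) j \<le> 4 * P * L * (D / E s * weight j) + Q * C * (u s j - w s j)"
      proof (rule field_diff_le[OF L C PQ(2) PQ(4)])
        show "u s i - w s i \<le> D / E s * weight i" for i
          using D[of i] E(1)[of s] weight_pos[of i] by (simp add: e_def field_simps)
        show "0 < u s j - w s j"
          using pos E(1)[of s] weight_pos[of j] by (simp add: e_def zero_less_mult_iff zero_less_divide_iff)
      qed (use sR in auto)
      then have "(field s (u s) j - field s (w s) j) * (E s / weight j)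
          \<le> (4 * P * L * (D / E s * weight j) + Q * C * (u s j - w s j)) * (E s / weight j)"
        using E(1)[of s] weight_pos[of j] by (intro mult_right_mono) auto
      also have "\<dots> = A * D + Q * C * e s j"
        using E(1)[of s] weight_pos[of j] by (simp add: A_def e_def field_simps)
      finally show "e' s j \<le> A * D - 2 * A * e s j"
        by (simp add: e'_def lam_def algebra_simps diff_divide_distrib)
    qed
    then have "u t k - w t k \<le> c * weight k / E t"
      using E(1)[of t] weight_pos[of k] by (simp add: e_def field_simps)
    also have "\<dots> = c * weight k * exp (lam * (t - t0))"
      by (simp add: E_def exp_minus inverse_eq_divide)
    finally show "u t k - w t k \<le> c * weight k * exp (lam * (t - t0))" .
  qed
  then show ?thesis ..
qed

lemma comparison:
  assumes u: "sol t0 u" and w: "sol t0 w" and start: "\<And>k. u t0 k \<le> w t0 k" and t: "t0 \<le> t"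
  shows "u t k \<le> w t k"
proof -
  obtain B1 where "\<forall>s\<in>{t0..t}. \<forall>k. \<bar>u s (k + 1) - u s k\<bar> \<le> B1"
    using sol_spacing[OF u, of t] by blast
  moreover obtain B2 where "\<forall>s\<in>{t0..t}. \<forall>k. \<bar>w s (k + 1) - w s k\<bar> \<le> B2"
    using sol_spacing[OF w, of t] by blast
  ultimately have B: "\<bar>u s (k + 1) - u s k\<bar> \<le> max B1 B2" "\<bar>w s (k + 1) - w s k\<bar> \<le> max B1 B2"
    if "s \<in> {t0..t}" for s k using that by (auto simp: le_max_iff_disj)
  obtain lam where lam: "growth_rate (max B1 B2) lam"
    using growth_rate_exists by blast
  have "u t k - w t k \<le> 0 * weight k * exp (lam * (t - t0))"
  proof (rule lam[unfolded growth_rate_def, rule_format, OF u w])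
    show "\<bar>u s (j + 1) - u s j\<bar> \<le> max B1 B2 \<and> \<bar>w s (j + 1) - w s j\<bar> \<le> max B1 B2"
      if "s \<in> {t0..t}" for s j using B[OF that, of j] by (rule conjI)
  qed (use start t in simp_all)
  then show ?thesis by simp
qed

text \<open>
  The shifts need not be equal and \<open>u\<close>, \<open>w\<close> may be the same solution.  The constant has to
  be an integer, because only integer translations commute with \<open>h\<close>.
\<close>

lemma comparison_shifted:
  assumes u: "sol t0 u" and w: "sol t0 w" and t: "t0 \<le> t"
    and start: "\<And>k. u t0 (k + i) \<le> w t0 (k + j) + of_int n"
  shows "u t (k + i) \<le> w t (k + j) + of_int n"
proof -
  have "u t (k + i) + of_int 0 \<le> w t (k + j) + of_int n"
    by (rule comparison[OF sol_symmetry[OF u] sol_symmetry[OF w] _ t, of i 0 j n k])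
      (simp add: start)
  then show ?thesis by simp
qed

section \<open>Solutions that start from linear configurations\<close>

text \<open>
  At the initial time \<open>u\<^sub>k\<^sub>+\<^sub>j - u\<^sub>k = j\<rho>\<close> lies between the integers \<open>\<lfloor>j\<rho>\<rfloor>\<close> and \<open>\<lceil>j\<rho>\<rceil>\<close>, and these
  bounds persist.
\<close>

lemma linear_spacing:
  assumes u: "sol t0 u" and lin: "\<And>k. u t0 k = \<theta> + of_int k * \<rho>" and t: "t0 \<le> t"
  shows "\<bar>u t (k + j) - u t k - of_int j * \<rho>\<bar> \<le> 1"
proof -
  have "u t (k + j) \<le> u t (k + 0) + of_int \<lceil>of_int j * \<rho>\<rceil>"
    by (rule comparison_shifted[OF u u t]) (simp add: lin algebra_simps)
  moreover have "u t (k + 0) \<le> u t (k + j) + of_int (- \<lfloor>of_int j * \<rho>\<rfloor>)"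
    by (rule comparison_shifted[OF u u t]) (simp add: lin algebra_simps)
  ultimately show ?thesis by (simp add: abs_le_iff) linarith
qed

lemma linear_spacing_neighbour:
  assumes "sol t0 u" "\<And>k. u t0 k = \<theta> + of_int k * \<rho>" "t0 \<le> t"
  shows "\<bar>u t (k + 1) - u t k\<bar> \<le> \<bar>\<rho>\<bar> + 1"
  using linear_spacing[OF assms, of k 1] by (simp add: abs_le_iff) linarith

lemma countable_N: "countable N"
proof -
  have "N = (\<Union>n::nat. N \<inter> {- real n..real n})"
  proof safe
    fix x assume "x \<in> N"
    obtain n :: nat where "\<bar>x\<bar> \<le> real n" using real_arch_simple by blast
    then show "x \<in> (\<Union>n::nat. N \<inter> {- real n..real n})" using \<open>x \<in> N\<close>
      by (auto simp: abs_le_iff intro!: exI[of _ n])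
  qed
  moreover have "countable (\<Union>n::nat. N \<inter> {- real n..real n})"
    by (rule countable_UN) (simp_all add: countable_finite finite_N)
  ultimately show ?thesis by simp
qed

lemma exists_sol_if_globally_lipschitz:
  assumes L: "L-lipschitz_on UNIV g" and range: "\<And>x. g x \<in> {a..b}"
    and u0: "\<And>k. \<bar>u0 (k + 1) - u0 k\<bar> \<le> B0"
  shows "\<exists>u. sol t0 u \<and> u t0 = u0"
proof -
  obtain M where "\<And>t u k. g (u (k + 1) - u k) \<in> {a..b} \<Longrightarrow> g (u k - u (k - 1)) \<in> {a..b}
      \<Longrightarrow> \<bar>field t u k\<bar> \<le> M"
    using field_bounded[of a b] by blast
  then have M: "\<bar>field t u k\<bar> \<le> M" for t u k using range[of "u (k + 1) - u k"] range[of "u k - u (k - 1)"] by this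
  obtain P Q where PQ: "0 \<le> P" "\<And>t. p t \<le> P" "0 \<le> Q" "\<And>t. \<bar>q t\<bar> \<le> Q"
    using coefficient_bounds by blast
  obtain C where C: "C-lipschitz_on UNIV h" using lipschitz_h by blast
  note L0 = lipschitz_on_nonneg[OF L] and C0 = lipschitz_on_nonneg[OF C]
  have lip: "\<bar>field t u k - field t w k\<bar> \<le> (4 * P * L + Q * C) * D"
    if D: "\<And>j. \<bar>u j - w j\<bar> \<le> D" for t u w k D
  proof -
    have D0: "0 \<le> D" using D[of 0] by linarith
    have g: "\<bar>g (u i - u j) - g (w i - w j)\<bar> \<le> L * (2 * D)" for i j
    proof -
      have "\<bar>g (u i - u j) - g (w i - w j)\<bar> \<le> L * \<bar>(u i - u j) - (w i - w j)\<bar>"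
        using lipschitz_onD[OF L, of "u i - u j" "w i - w j"] by (simp add: dist_real_def)
      also have "\<dots> \<le> L * (2 * D)" using D[of i] D[of j] by (intro mult_left_mono L0) linarith
      finally show ?thesis .
    qed
    let ?G = "\<lambda>v. g (v (k + 1) - v k) - g (v k - v (k - 1))"
    have "\<bar>?G u - ?G w\<bar> \<le> 4 * L * D" using g[of "k + 1" k] g[of k "k - 1"] by linarith
    then have "p t * \<bar>?G u - ?G w\<bar> \<le> P * (4 * L * D)"
      using PQ by (intro mult_mono) auto
    moreover have "\<bar>h (u k) - h (w k)\<bar> \<le> C * \<bar>u k - w k\<bar>"
      using lipschitz_onD[OF C, of "u k" "w k"] by (simp add: dist_real_def)
    then have "\<bar>h (u k) - h (w k)\<bar> \<le> C * D"
      using mult_left_mono[OF D[of k] C0] by linarith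
    then have "\<bar>q t\<bar> * \<bar>h (u k) - h (w k)\<bar> \<le> Q * (C * D)"
      using PQ by (intro mult_mono) auto
    moreover have "field t u k - field t w k = p t * (?G u - ?G w) + q t * (h (u k) - h (w k))"
      by (simp add: field_def algebra_simps)
    then have "\<bar>field t u k - field t w k\<bar> \<le> p t * \<bar>?G u - ?G w\<bar> + \<bar>q t\<bar> * \<bar>h (u k) - h (w k)\<bar>"
      using abs_triangle_ineq[of "p t * (?G u - ?G w)" "q t * (h (u k) - h (w k))"] p_nonneg[of t]
      by (simp add: abs_mult)
    ultimately show ?thesis by (simp add: algebra_simps)
  qed
  have contg: "isCont g x" "isCont h x" for x
    using lipschitz_on_continuous_on[OF L] lipschitz_on_continuous_on[OF C]
    by (auto simp: continuous_on_eq_continuous_at)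
  have cont: "isCont (\<lambda>s. field s (u s) k) t" if "\<And>j. isCont (\<lambda>s. u s j) t" "t \<notin> N" for u k t
    unfolding field_def using that
    by (intro continuous_intros cont_p cont_q isCont_o2[OF _ contg(1)] isCont_o2[OF _ contg(2)]) auto
  have K0: "0 \<le> 4 * P * L + Q * C" using PQ L0 C0 by simp
  obtain u where u: "\<And>k. u t0 k = u0 k" "\<And>k. continuous_on UNIV (\<lambda>t. u t k)"
    "\<And>t k. t0 \<le> t \<Longrightarrow> t \<notin> N \<Longrightarrow> ((\<lambda>s. u s k) has_real_derivative field t (u t) k) (at t within {t0..})"
    "\<And>t k. t0 \<le> t \<Longrightarrow> \<bar>u t k - u0 k\<bar> \<le> M * (t - t0)"
    by (rule picard_lattice[of field M "4 * P * L + Q * C" N t0 u0, OF M lip K0 countable_N cont])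
      (assumption | rule that)+
  have M0: "0 \<le> M" using M[of 0 u0 0] by linarith
  have "\<bar>u t (k + 1) - u t k\<bar> \<le> B0 + 2 * (M * (b - t0))" if "t \<in> {t0..b}" for t b k
  proof -
    have "M * (t - t0) \<le> M * (b - t0)" using that M0 by (intro mult_left_mono) auto
    then show ?thesis using u(4)[of t k] u(4)[of t "k + 1"] u0[of k] that by (auto simp: abs_le_iff)
  qed
  then have "\<exists>B. \<forall>t\<in>{t0..b}. \<forall>k. \<bar>u t (k + 1) - u t k\<bar> \<le> B" for b by blast
  then have "sol t0 u"
    unfolding sol_def using u(3) continuous_on_subset[OF u(2) subset_UNIV] by simp
  with u(1) show ?thesis by blast
qed

text \<open>
  The a priori bound \<open>\<bar>u\<^sub>k\<^sub>+\<^sub>1 - u\<^sub>k\<bar> \<le> \<bar>\<rho>\<bar> + 1\<close> holds for any increasing \<open>g\<close>, in particular for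
  the truncated one, and it shows that the truncation is never active.
\<close>

lemma exists_linear_sol:
  "\<exists>u. sol t0 u \<and> (\<forall>k. u t0 k = \<theta> + of_int k * \<rho>)"
proof -
  define R where "R = \<bar>\<rho>\<bar> + 1"
  define cut where "cut x = max (- R) (min R x)" for x
  have R: "0 < R" by (simp add: R_def)
  have cut: "cut x \<in> {- R..R}" "\<bar>cut x - cut y\<bar> \<le> \<bar>x - y\<bar>" for x y using R by (auto simp: cut_def)
  have cut_id: "cut x = x" if "\<bar>x\<bar> \<le> R" for x using that by (auto simp: cut_def)
  obtain L where L: "L-lipschitz_on {-R..R} g" using lipschitz_g by blast
  have lip: "L-lipschitz_on S (\<lambda>x. g (cut x))" for S
  proof (rule lipschitz_onI)
    fix x y
    have "dist (g (cut x)) (g (cut y)) \<le> L * dist (cut x) (cut y)"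
      by (intro lipschitz_onD[OF L] cut)
    also have "\<dots> \<le> L * dist x y"
      using cut(2) by (intro mult_left_mono lipschitz_on_nonneg[OF L]) (simp add: dist_real_def)
    finally show "dist (g (cut x)) (g (cut y)) \<le> L * dist x y" .
  qed (rule lipschitz_on_nonneg[OF L])
  interpret cut: lattice_chain "\<lambda>x. g (cut x)" h p q N
  proof
    show "mono (\<lambda>x. g (cut x))" by (intro monoI monoD[OF mono_g]) (auto simp: cut_def)
    show "\<exists>L. L-lipschitz_on {- R..R} (\<lambda>x. g (cut x))" for R using lip by blast
  qed (fact lipschitz_h periodic_h p_nonneg bounded_p bounded_q finite_N cont_p cont_q | assumption)+
  have "g (cut x) \<in> {g (- R)..g R}" for x using cut(1)[of x] by (auto intro!: monoD[OF mono_g])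
  from cut.exists_sol_if_globally_lipschitz[OF lip this, of "\<lambda>k. \<theta> + of_int k * \<rho>" "\<bar>\<rho>\<bar>" t0]
  obtain u where u: "cut.sol t0 u" "u t0 = (\<lambda>k. \<theta> + of_int k * \<rho>)"
    by (auto simp: algebra_simps)
  have spacing: "\<bar>u t (k + 1) - u t k\<bar> \<le> R" if "t0 \<le> t" for t k
    unfolding R_def by (rule cut.linear_spacing_neighbour[OF u(1) _ that]) (simp add: u(2))
  have "cut.field t (u t) k = field t (u t) k" if "t0 \<le> t" for t k
    using spacing[OF that, of k] spacing[OF that, of "k - 1"]
    by (simp add: cut.field_def field_def cut_id)
  then have "sol t0 u"
    using u(1) by (simp add: sol_def cut.sol_def)
  with u(2) show ?thesis by auto
qed

end

section \<open>The advance per period\<close>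

locale periodic_lattice_chain = lattice_chain +
  fixes T :: real
  assumes T_pos: "0 < T"
    and periodic_p: "\<And>t. p (t + T) = p t" and periodic_q: "\<And>t. q (t + T) = q t"
    and periodic_N: "\<And>t. t + T \<in> N \<longleftrightarrow> t \<in> N"
begin

lemma field_periodic: "field (real m * T + t) = field t"
  and N_periodic: "real m * T + t \<in> N \<longleftrightarrow> t \<in> N"
proof -
  interpret p: periodic_fun_simple p T by standard (rule periodic_p)
  interpret q: periodic_fun_simple q T by standard (rule periodic_q)
  interpret N: periodic_fun_simple "\<lambda>t. t \<in> N" T by standard (rule periodic_N)
  show "field (real m * T + t) = field t"
    using p.plus_of_nat[of t m] q.plus_of_nat[of t m] by (simp add: fun_eq_iff field_def add.commute)
  show "real m * T + t \<in> N \<longleftrightarrow> t \<in> N" using N.plus_of_nat[of t m] by (simp add: add.commute)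
qed

lemma sol_time_shift:
  assumes u: "sol t0 u"
  shows "sol t0 (\<lambda>t. u (real m * T + t))"
  unfolding sol_def
proof (intro conjI allI impI)
  let ?s = "real m * T"
  have s: "0 \<le> ?s" using T_pos by simp
  fix b
  obtain B where B: "\<forall>t\<in>{t0..?s + b}. \<forall>k. \<bar>u t (k + 1) - u t k\<bar> \<le> B"
    using sol_spacing[OF u, of "?s + b"] by blast
  have "\<bar>u (?s + t) (k + 1) - u (?s + t) k\<bar> \<le> B" if "t \<in> {t0..b}" for t k
    using B[rule_format, of "?s + t" k] that s by simp
  then show "\<exists>B. \<forall>t\<in>{t0..b}. \<forall>k. \<bar>u (?s + t) (k + 1) - u (?s + t) k\<bar> \<le> B" by blast
  fix k
  show "continuous_on {t0..} (\<lambda>t. u (?s + t) k)"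
    by (rule continuous_on_compose2[OF sol_continuous[OF u, of k]])
      (use s in \<open>auto intro!: continuous_intros\<close>)
  fix t assume t: "t0 \<le> t" "t \<notin> N"
  have "((\<lambda>r. u r k) has_real_derivative field (?s + t) (u (?s + t)) k) (at (?s + t) within {t0..})"
    using u t s by (simp add: sol_def N_periodic)
  then have "((\<lambda>r. u r k) has_real_derivative field (?s + t) (u (?s + t)) k)
      (at (?s + t) within (+) ?s ` {t0..})"
    by (rule DERIV_subset) (use s in auto)
  then show "((\<lambda>r. u (?s + r) k) has_real_derivative field t (u (?s + t)) k) (at t within {t0..})"
    by (simp only: DERIV_at_within_shift field_periodic)
qed

definition linear_sol :: "real \<Rightarrow> real \<Rightarrow> real \<Rightarrow> real \<Rightarrow> int \<Rightarrow> real" where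
  "linear_sol \<rho> t0 \<theta> = (SOME u. sol t0 u \<and> (\<forall>k. u t0 k = \<theta> + of_int k * \<rho>))"

lemma sol_linear_sol: "sol t0 (linear_sol \<rho> t0 \<theta>)"
  and linear_sol_start: "linear_sol \<rho> t0 \<theta> t0 k = \<theta> + of_int k * \<rho>"
  using someI_ex[OF exists_linear_sol[of t0 \<theta> \<rho>]] by (simp_all add: linear_sol_def)

definition displacement :: "real \<Rightarrow> real \<Rightarrow> real \<Rightarrow> nat \<Rightarrow> real" where
  "displacement \<rho> t0 \<theta> m = linear_sol \<rho> t0 \<theta> (real m * T + t0) 0 - \<theta>"

text \<open>
  At time \<open>t0\<close> the whole configuration lies within the integer \<open>n\<close> of the linear one through
  \<open>u\<^sub>k\<close>, so it stays there.  The linear solution is indexed from \<open>k\<close>, hence compared at 0.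
\<close>

lemma close_to_linear_sol:
  assumes u: "sol t0 u" and width: "\<And>j. \<bar>u t0 (k + j) - u t0 k - of_int j * \<rho>\<bar> \<le> of_int n"
    and t: "t0 \<le> t"
  shows "\<bar>u t k - linear_sol \<rho> t0 (u t0 k) t 0\<bar> \<le> of_int n"
proof -
  let ?w = "linear_sol \<rho> t0 (u t0 k)"
  have w: "\<bar>u t0 (j + k) - ?w t0 (j + 0)\<bar> \<le> of_int n" for j
    using width[of j] by (simp add: linear_sol_start add.commute algebra_simps)
  have "u t (0 + k) \<le> ?w t (0 + 0) + of_int n"
    by (rule comparison_shifted[OF u sol_linear_sol t]) (use w in \<open>simp add: abs_le_iff algebra_simps\<close>)
  moreover have "?w t (0 + 0) \<le> u t (0 + k) + of_int n"
    by (rule comparison_shifted[OF sol_linear_sol u t]) (use w in \<open>simp add: abs_le_iff algebra_simps\<close>)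
  ultimately show ?thesis by (simp add: abs_le_iff)
qed

text \<open>
  \<open>\<theta>'\<close> lies between \<open>\<theta> + i\<close> and \<open>\<theta> + i + 1\<close> for an integer \<open>i\<close>, and the positions after \<open>m\<close>
  periods are in the same order.
\<close>

lemma displacement_phase: "\<bar>displacement \<rho> t0 \<theta> m - displacement \<rho> t0 \<theta>' m\<bar> \<le> 1"
proof -
  define i where "i = \<lfloor>\<theta>' - \<theta>\<rfloor>"
  let ?w = "linear_sol \<rho> t0" and ?t = "real m * T + t0"
  have i: "of_int i \<le> \<theta>' - \<theta>" "\<theta>' - \<theta> < of_int i + 1" by (auto simp: i_def)
  have t: "t0 \<le> ?t" using T_pos by simp
  have "?w \<theta> ?t (0 + 0) \<le> ?w \<theta>' ?t (0 + 0) + of_int (- i)"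
    by (rule comparison_shifted[OF sol_linear_sol sol_linear_sol t]) (use i in \<open>simp add: linear_sol_start\<close>)
  moreover have "?w \<theta>' ?t (0 + 0) \<le> ?w \<theta> ?t (0 + 0) + of_int (i + 1)"
    by (rule comparison_shifted[OF sol_linear_sol sol_linear_sol t]) (use i in \<open>simp add: linear_sol_start\<close>)
  ultimately show ?thesis using i by (simp add: displacement_def abs_le_iff)
qed

text \<open>
  After \<open>m\<close> periods, \<open>linear_spacing\<close> puts the solution within 1 of a linear configuration,
  so up to an error of 1 the next \<open>l\<close> periods look like a fresh start with phase \<open>y\<close>.  Another
  error of 1 brings \<open>y\<close> back to \<open>\<theta>\<close>.
\<close>

lemma displacement_quasi_additive:
  "\<bar>displacement \<rho> t0 \<theta> (m + l) - displacement \<rho> t0 \<theta> m - displacement \<rho> t0 \<theta> l\<bar> \<le> 2"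
proof -
  let ?w = "linear_sol \<rho> t0 \<theta>"
  define y where "y = ?w (real m * T + t0) 0"
  have t: "t0 \<le> real m * T + t0" "t0 \<le> real l * T + t0" using T_pos by simp_all
  have width: "\<bar>?w (real m * T + t0) (0 + j) - ?w (real m * T + t0) 0 - of_int j * \<rho>\<bar> \<le> of_int 1" for j
    by (simp only: of_int_1) (rule linear_spacing[OF sol_linear_sol linear_sol_start t(1)])
  have "\<bar>?w (real m * T + (real l * T + t0)) 0 - linear_sol \<rho> t0 y (real l * T + t0) 0\<bar> \<le> of_int 1"
    unfolding y_def
    by (rule close_to_linear_sol[OF sol_time_shift[OF sol_linear_sol] width t(2)])
  then have "\<bar>displacement \<rho> t0 \<theta> (m + l) - displacement \<rho> t0 \<theta> m - displacement \<rho> t0 y l\<bar> \<le> 1"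
    by (simp add: displacement_def y_def algebra_simps)
  with displacement_phase[of \<rho> t0 y l \<theta>] show ?thesis by linarith
qed

text \<open>
  The choice of the phase 0 is immaterial: displacements for different phases differ by at
  most 1, so they have the same slope.
\<close>

definition advance :: "real \<Rightarrow> real \<Rightarrow> real" where
  "advance \<rho> t0 = (SOME c. \<forall>m. \<bar>displacement \<rho> t0 0 m - real m * c\<bar> \<le> 2)"

lemma displacement_near_advance: "\<bar>displacement \<rho> t0 \<theta> m - real m * advance \<rho> t0\<bar> \<le> 2"
proof -
  have near: "\<exists>c. \<forall>m. \<bar>displacement \<rho> t0 \<theta> m - real m * c\<bar> \<le> 2" for \<theta>
    by (rule quasi_additive_imp_near_linear[of "displacement \<rho> t0 \<theta>" 2,
          OF displacement_quasi_additive]) blast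
  have adv: "\<bar>displacement \<rho> t0 0 m - real m * advance \<rho> t0\<bar> \<le> 2" for m
    using someI_ex[OF near[of 0]] by (simp add: advance_def)
  obtain c where c: "\<And>m. \<bar>displacement \<rho> t0 \<theta> m - real m * c\<bar> \<le> 2" using near by blast
  have "\<bar>real m * c - real m * advance \<rho> t0\<bar> \<le> 5" for m
    using c[of m] adv[of m] displacement_phase[of \<rho> t0 \<theta> m 0] by linarith
  then have "c = advance \<rho> t0" by (rule eq_if_bounded_multiples)
  with c show ?thesis by simp
qed

lemma sol_near_advance:
  assumes u: "sol t0 u" and width: "\<And>j. \<bar>u t0 (k + j) - u t0 k - of_int j * \<rho>\<bar> \<le> of_int n"
  shows "\<bar>u (real m * T + t0) k - u t0 k - real m * advance \<rho> t0\<bar> \<le> of_int n + 2"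
proof -
  have "t0 \<le> real m * T + t0" using T_pos by simp
  from close_to_linear_sol[OF u width this] displacement_near_advance[of \<rho> t0 "u t0 k" m]
  show ?thesis by (simp add: displacement_def)
qed

text \<open>
  One linear solution, started at \<open>t0\<close>, measures both advances, since at \<open>t1\<close> it still
  has width 1.  Its positions at times \<open>t1 - t0\<close> apart differ by a bounded amount, which does
  not change the slope.
\<close>

lemma advance_later_time:
  assumes "t0 \<le> t1"
  shows "advance \<rho> t0 = advance \<rho> t1"
proof -
  let ?w = "linear_sol \<rho> t0 0"
  obtain M where M: "\<And>t u k. \<forall>j. \<bar>u (j + 1) - u j\<bar> \<le> \<bar>\<rho>\<bar> + 1 \<Longrightarrow> \<bar>field t u k\<bar> \<le> M"
    using field_bounded_spacing[of "\<bar>\<rho>\<bar> + 1"] by blast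
  have drift: "\<bar>?w (real m * T + t1) 0 - ?w (real m * T + t0) 0\<bar> \<le> M * (t1 - t0)" for m
  proof -
    have t: "t0 \<le> real m * T + t0" using T_pos by simp
    have "\<bar>?w (real m * T + t1) 0 - ?w (real m * T + t0) 0\<bar> \<le> M * (real m * T + t1 - (real m * T + t0))"
    proof (rule drift_bound[OF sol_later[OF sol_linear_sol t], of "real m * T + t1"])
      fix s k assume "s \<in> {real m * T + t0..real m * T + t1}"
      then have "t0 \<le> s" using t by auto
      then show "\<bar>field s (?w s) k\<bar> \<le> M"
        by (intro M allI linear_spacing_neighbour[OF sol_linear_sol linear_sol_start])
    qed (use assms in auto)
    then show ?thesis by simp
  qed
  have width: "\<bar>?w t1 (0 + j) - ?w t1 0 - of_int j * \<rho>\<bar> \<le> of_int 1" for j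
    by (simp only: of_int_1) (rule linear_spacing[OF sol_linear_sol linear_sol_start assms])
  have "\<bar>real m * advance \<rho> t0 - real m * advance \<rho> t1\<bar> \<le> 5 + 2 * (M * (t1 - t0))" for m
    using sol_near_advance[OF sol_later[OF sol_linear_sol assms] width, of m]
      displacement_near_advance[of \<rho> t0 0 m] drift[of m] drift[of 0]
    by (simp add: displacement_def linear_sol_start abs_le_iff)
  then show ?thesis by (rule eq_if_bounded_multiples)
qed

lemma advance_time: "advance \<rho> t0 = advance \<rho> t1"
  using advance_later_time[of t0 t1 \<rho>] advance_later_time[of t1 t0 \<rho>] by linarith

text \<open>
  \<open>\<delta>\<close> is chosen to balance the growth factor over \<open>m\<close> periods.  The bound 1 on the right is
  enough, since the displacement determines \<open>m\<close> times the advance only up to a constant.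
\<close>

lemma displacement_continuous:
  "\<exists>\<delta>>0. \<forall>\<rho>'. \<bar>\<rho>' - \<rho>\<bar> \<le> \<delta> \<longrightarrow> \<bar>displacement \<rho>' t0 0 m - displacement \<rho> t0 0 m\<bar> \<le> 1"
proof -
  obtain lam where lam: "growth_rate (\<bar>\<rho>\<bar> + 2) lam" using growth_rate_exists by blast
  define \<delta> where "\<delta> = min 1 (exp (- lam * (real m * T)))"
  let ?t = "real m * T + t0"
  have t: "?t \<in> {t0..?t}" using T_pos by simp
  have le: "displacement a t0 0 m - displacement b t0 0 m \<le> 1"
    if "\<bar>a - b\<bar> \<le> \<delta>" "\<bar>a\<bar> \<le> \<bar>\<rho>\<bar> + 1" "\<bar>b\<bar> \<le> \<bar>\<rho>\<bar> + 1" for a b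
  proof -
    have "linear_sol a t0 0 ?t 0 - linear_sol b t0 0 ?t 0 \<le> \<delta> * weight 0 * exp (lam * (?t - t0))"
    proof (rule lam[unfolded growth_rate_def, rule_format, OF sol_linear_sol sol_linear_sol _ _ _ t])
      fix s k assume "s \<in> {t0..?t}"
      then have "t0 \<le> s" by simp
      from linear_spacing_neighbour[OF sol_linear_sol linear_sol_start this, of a 0 k]
        linear_spacing_neighbour[OF sol_linear_sol linear_sol_start this, of b 0 k]
      show "\<bar>linear_sol a t0 0 s (k + 1) - linear_sol a t0 0 s k\<bar> \<le> \<bar>\<rho>\<bar> + 2 \<and>
          \<bar>linear_sol b t0 0 s (k + 1) - linear_sol b t0 0 s k\<bar> \<le> \<bar>\<rho>\<bar> + 2"
        using that(2,3) by linarith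
    next
      fix k
      have "linear_sol a t0 0 t0 k - linear_sol b t0 0 t0 k = (a - b) * of_int k"
        by (simp add: linear_sol_start algebra_simps)
      also have "\<dots> \<le> \<bar>a - b\<bar> * \<bar>of_int k\<bar>" by (simp add: abs_mult[symmetric])
      also have "\<dots> \<le> \<delta> * weight k" using that(1) abs_le_weight by (intro mult_mono) auto
      finally show "linear_sol a t0 0 t0 k - linear_sol b t0 0 t0 k \<le> \<delta> * weight k" .
    qed (simp add: \<delta>_def)
    also have "\<dots> \<le> exp (- lam * (real m * T)) * exp (lam * (real m * T))"
      by (simp add: \<delta>_def weight_def)
    also have "\<dots> = 1" by (simp add: exp_add[symmetric])
    finally show ?thesis by (simp add: displacement_def)
  qed
  have "\<bar>displacement \<rho>' t0 0 m - displacement \<rho> t0 0 m\<bar> \<le> 1" if "\<bar>\<rho>' - \<rho>\<bar> \<le> \<delta>" for \<rho>'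
  proof -
    have "\<bar>\<rho>'\<bar> \<le> \<bar>\<rho>\<bar> + 1" using that by (simp add: \<delta>_def) linarith
    then show ?thesis
      using le[of \<rho>' \<rho>] le[of \<rho> \<rho>'] that by (simp add: abs_le_iff abs_minus_commute)
  qed
  moreover have "0 < \<delta>" by (simp add: \<delta>_def)
  ultimately show ?thesis by blast
qed

lemma continuous_advance: "continuous_on UNIV (\<lambda>\<rho>. advance \<rho> t0)"
  unfolding continuous_on_iff
proof (intro ballI allI impI)
  fix \<rho> e :: real assume "0 < e"
  obtain m :: nat where m: "5 / e < real m" using reals_Archimedean2 by blast
  have "0 < 5 / e" using \<open>0 < e\<close> by simp
  with m have m0: "0 < real m" by linarith
  obtain \<delta> where \<delta>: "0 < \<delta>"
    "\<And>\<rho>'. \<bar>\<rho>' - \<rho>\<bar> \<le> \<delta> \<Longrightarrow> \<bar>displacement \<rho>' t0 0 m - displacement \<rho> t0 0 m\<bar> \<le> 1"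
    using displacement_continuous by blast
  have "dist (advance \<rho>' t0) (advance \<rho> t0) < e" if "dist \<rho>' \<rho> < \<delta>" for \<rho>'
  proof -
    have "\<bar>real m * advance \<rho>' t0 - real m * advance \<rho> t0\<bar> \<le> 5"
      using \<delta>(2)[of \<rho>'] that displacement_near_advance[of \<rho>' t0 0 m] displacement_near_advance[of \<rho> t0 0 m]
      by (simp add: dist_real_def)
    then have "real m * \<bar>advance \<rho>' t0 - advance \<rho> t0\<bar> \<le> 5"
      by (simp only: right_diff_distrib[symmetric] abs_mult abs_of_nat)
    also have "5 < real m * e" using m \<open>0 < e\<close> by (simp add: field_simps)
    finally show ?thesis using m0 by (simp add: dist_real_def)
  qed
  with \<delta>(1) show "\<exists>d>0. \<forall>\<rho>'\<in>UNIV. dist \<rho>' \<rho> < d \<longrightarrow> dist (advance \<rho>' t0) (advance \<rho> t0) < e"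
    by blast
qed

end

section \<open>The lattice systems (R1) and (R2)\<close>

lemma C2_has_second_deriv:
  assumes "C2 f"
  shows "(deriv f has_real_derivative deriv (deriv f) x) (at x)"
  using assms by (auto simp: C2_def DERIV_deriv_iff_real_differentiable)

lemma lipschitz_on_if_deriv_bounded:
  fixes f :: "real \<Rightarrow> real"
  assumes "\<And>x. (f has_real_derivative f' x) (at x)" "convex X"
    "\<And>x. x \<in> X \<Longrightarrow> \<bar>f' x\<bar> \<le> C" "0 \<le> C"
  shows "C-lipschitz_on X f"
proof (rule bounded_derivative_imp_lipschitz[OF _ assms(2) _ assms(4)])
  show "(f has_derivative (\<lambda>h. h * f' x)) (at x within X)" for x
    using assms(1)[of x] has_derivative_at_withinI
    by (auto simp: has_field_derivative_def mult.commute[of _ "f' x"])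
  show "onorm (\<lambda>h. h * f' x) \<le> C" if "x \<in> X" for x
    by (rule onorm_bound) (use assms(3)[OF that] assms(4) in
      \<open>auto simp: abs_mult mult.commute[of C] intro!: mult_left_mono\<close>)
qed

lemma C2_deriv_lipschitz:
  assumes "C2 f"
  shows "\<exists>L. L-lipschitz_on {-R..R} (deriv f)"
proof -
  have "compact (deriv (deriv f) ` {-R..R})"
    using assms by (intro compact_continuous_image) (auto simp: C2_def intro: continuous_on_subset)
  then have "bounded (deriv (deriv f) ` {-R..R})" by (rule compact_imp_bounded)
  then obtain B where B: "\<forall>x\<in>{-R..R}. \<bar>deriv (deriv f) x\<bar> \<le> B"
    by (auto simp: bounded_iff)
  have "(max B 0)-lipschitz_on {-R..R} (deriv f)"
    by (rule lipschitz_on_if_deriv_bounded[OF C2_has_second_deriv[OF assms]])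
      (use B in \<open>auto simp: le_max_iff_disj\<close>)
  then show ?thesis ..
qed

lemma periodic_deriv:
  fixes f :: "real \<Rightarrow> real"
  assumes "\<And>x. f (x + 1) = f x"
  shows "deriv f (x + 1) = deriv f x"
proof -
  have "(f has_real_derivative y) (at (x + 1)) \<longleftrightarrow> (f has_real_derivative y) (at x)" for y
    using DERIV_shift[of f y x 1] assms by (simp add: fun_eq_iff)
  then show ?thesis by (simp add: deriv_def)
qed

lemma C2_periodic_deriv_lipschitz:
  assumes f: "C2 f" and per: "\<And>x. f (x + 1) = f x"
  shows "\<exists>L. L-lipschitz_on UNIV (deriv f)"
proof -
  let ?f = "deriv (deriv f)"
  interpret periodic_fun_simple' ?f
    by standard (rule periodic_deriv[of "deriv f", OF periodic_deriv[of f, OF per]])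
  have "compact (?f ` {0..1})"
    using f by (intro compact_continuous_image) (auto simp: C2_def intro: continuous_on_subset)
  then have "bounded (?f ` {0..1})" by (rule compact_imp_bounded)
  then obtain B where B: "\<forall>x\<in>{0..1}. \<bar>?f x\<bar> \<le> B"
    by (auto simp: bounded_iff)
  have "\<bar>?f x\<bar> \<le> B" for x
    using B[rule_format, of "frac x"] plus_of_int[of "frac x" "\<lfloor>x\<rfloor>"] frac_ge_0[of x] frac_lt_1[of x]
    by (simp add: frac_def)
  moreover have "0 \<le> B" using B[rule_format, of 0] by auto
  ultimately have "B-lipschitz_on UNIV (deriv f)"
    by (intro lipschitz_on_if_deriv_bounded[OF C2_has_second_deriv[OF f]]) auto
  then show ?thesis ..
qed

lemma isCont_periodic:
  fixes K :: "real \<Rightarrow> real"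
  assumes "\<And>t. K (t + T) = K t"
  shows "isCont K (t + T) \<longleftrightarrow> isCont K t"
proof -
  have "K (t + T + h) = K (t + h)" for h using assms[of "t + h"] by (simp add: ac_simps)
  then show ?thesis using assms[of t] by (simp add: isCont_iff)
qed

text \<open>
  For \<open>j < 0\<close> this is the defining inequality with the roles of the two particles exchanged.
\<close>

lemma bounded_width_two_sided:
  assumes "bounded_width \<rho> n u"
  shows "\<bar>u (k + j) - u k - of_int j * \<rho>\<bar> \<le> of_int n"
proof -
  have W: "\<bar>u (i + l) - u i - of_int l * \<rho>\<bar> \<le> of_int n" if "1 \<le> l" for i l
    using assms that by (auto simp: bounded_width_def)
  consider "1 \<le> j" | "j = 0" | "1 \<le> - j" by linarith
  then show ?thesis
  proof cases
    case 1 then show ?thesis by (rule W)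
  next
    case 2
    have "0 \<le> (of_int n :: real)" using W[of 1 0] by linarith
    with 2 show ?thesis by simp
  next
    case 3
    from W[OF 3, of "k + j"] show ?thesis by (simp add: abs_le_iff)
  qed
qed

lemma bounded_width_linear:
  assumes "1 \<le> n"
  shows "bounded_width \<rho> n (\<lambda>k. \<theta> + of_int k * \<rho>)"
  using assms by (simp add: bounded_width_def algebra_simps)

text \<open>
  The speed is the advance per period divided by the period.  Every other candidate is within
  \<open>6 / (m T)\<close> of it for all \<open>m\<close>, as both are tested on the linear solution of slope \<open>\<rho>\<close>, which
  has width 1.
\<close>

lemma (in periodic_lattice_chain) transport_speed:
  assumes S: "\<And>t u k. vector_field S W V K t u k = field t u k"
    and N: "N = {t. \<not> isCont K t}" and T: "T = 2 * \<tau>"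
  shows "(\<exists>!v. is_transport_speed S W V K \<tau> v)
    \<and> (\<forall>v. is_transport_speed S W V K \<tau> v \<longrightarrow> continuous_on UNIV v)"
proof -
  have mem_N: "t \<in> N \<longleftrightarrow> \<not> isCont K t" for t by (simp add: N)
  have sol: "is_solution S W V K t0 u \<longleftrightarrow> sol t0 u" for t0 u
    by (simp add: is_solution_def sol_def S mem_N)
  define v where "v \<rho> = advance \<rho> 0 / T" for \<rho>
  have v: "is_transport_speed S W V K \<tau> v"
    unfolding is_transport_speed_def
  proof (intro allI impI)
    fix u0 u \<rho> t0 k and n m :: int
    assume "1 \<le> n" and width: "bounded_width \<rho> n u0" and "1 \<le> m"
      and u: "is_solution S W V K t0 u" "u t0 = u0"
    define d where "d = 2 * of_int m * \<tau>"
    have d: "real (nat m) * T = d" "0 < d" using \<open>1 \<le> m\<close> T_pos by (simp_all add: T d_def)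
    have "\<bar>u (real (nat m) * T + t0) k - u t0 k - real (nat m) * advance \<rho> t0\<bar> \<le> of_int n + 2"
      by (rule sol_near_advance) (use u sol bounded_width_two_sided[OF width] in auto)
    moreover have "real (nat m) * advance \<rho> t0 = d * v \<rho>"
      using advance_time[of \<rho> t0 0] T_pos by (simp add: v_def d(1)[symmetric])
    ultimately have "\<bar>u (t0 + d) k - u t0 k - d * v \<rho>\<bar> \<le> of_int n + 2"
      by (simp only: d(1) add.commute[of d])
    moreover have "(u (t0 + d) k - u t0 k) / d - v \<rho> = (u (t0 + d) k - u t0 k - d * v \<rho>) / d"
      using d(2) by (simp add: field_simps)
    ultimately show "\<bar>(u (t0 + 2 * of_int m * \<tau>) k - u t0 k) / (2 * of_int m * \<tau>) - v \<rho>\<bar>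
        \<le> (of_int n + 2) / (2 * of_int m * \<tau>)"
      using d(2) by (simp add: d_def[symmetric] divide_right_mono)
  qed
  have unique: "w = v" if w: "is_transport_speed S W V K \<tau> w" for w
  proof
    fix \<rho>
    let ?u = "linear_sol \<rho> 0 0"
    have "\<bar>real m * w \<rho> - real m * v \<rho>\<bar> \<le> 6 / T" if m: "1 \<le> m" for m
    proof -
      define d where "d = 2 * of_int (int m) * \<tau>"
      have d: "d = real m * T" "0 < d" using m T_pos by (simp_all add: T d_def)
      let ?q = "(?u (0 + d) 0 - ?u 0 0) / d"
      have start: "?u 0 = (\<lambda>k. 0 + of_int k * \<rho>)" by (rule ext) (rule linear_sol_start)
      have width: "bounded_width \<rho> 1 (?u 0)" unfolding start by (rule bounded_width_linear) simp
      have dev: "\<bar>?q - x \<rho>\<bar> \<le> (of_int 1 + 2) / d" if "is_transport_speed S W V K \<tau> x" for x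
        using that[unfolded is_transport_speed_def, rule_format, of 1 \<rho> "?u 0" "int m" 0 ?u 0]
          width m
        by (simp add: d_def sol sol_linear_sol)
      from dev[OF w] dev[OF v] have "\<bar>w \<rho> - v \<rho>\<bar> \<le> 6 / d" by (simp add: abs_le_iff)
      then have "real m * \<bar>w \<rho> - v \<rho>\<bar> \<le> real m * (6 / d)" by (intro mult_left_mono) auto
      also have "\<dots> = 6 / T" using m by (simp add: d(1))
      finally show ?thesis by (simp only: right_diff_distrib[symmetric] abs_mult abs_of_nat)
    qed
    then show "w \<rho> = v \<rho>" by (rule eq_if_bounded_multiples)
  qed
  have "continuous_on UNIV v"
    unfolding v_def using T_pos by (intro continuous_intros continuous_advance) auto
  with v unique show ?thesis by blast
qed

theorem theorem2p1:
  fixes S :: lattice_system and W V K :: "real \<Rightarrow> real" and \<tau> :: real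
  assumes "C2 W" and "C2 V"
    and "\<exists>c>0. \<forall>x. c \<le> deriv (deriv W) x"
    and "\<forall>x. V (x + 1) = V x"
    and "\<tau> > 0"
    and "piecewise_continuous K" and "bounded (range K)"
    and "\<forall>t. K (t + 2 * \<tau>) = K t"
    and "S = R2 \<Longrightarrow> \<exists>c>0. \<forall>t. c \<le> K t"
  shows "(\<exists>!v. is_transport_speed S W V K \<tau> v)
    \<and> (\<forall>v. is_transport_speed S W V K \<tau> v \<longrightarrow> continuous_on UNIV v)"
proof -
  define N where "N = {t. \<not> isCont K t}"
  define p where "p = (case S of R1 \<Rightarrow> (\<lambda>_. 1) | R2 \<Rightarrow> K)"
  define q where "q = (case S of R1 \<Rightarrow> K | R2 \<Rightarrow> (\<lambda>_. 1))"
  have per_V: "V (x + 1) = V x" for x using assms(4) by blast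
  have per_K: "K (t + 2 * \<tau>) = K t" for t using assms(8) by blast
  interpret periodic_lattice_chain "deriv W" "deriv V" p q N "2 * \<tau>"
  proof
    show "mono (deriv W)"
    proof (rule monoI)
      fix x y :: real assume "x \<le> y"
      obtain c where "c > 0" "\<And>x. c \<le> deriv (deriv W) x" using assms(3) by blast
      then have "0 \<le> deriv (deriv W) x" for x by (meson less_imp_le order_trans)
      then show "deriv W x \<le> deriv W y"
        using C2_has_second_deriv[OF assms(1)] by (intro DERIV_nonneg_imp_nondecreasing[OF \<open>x \<le> y\<close>]) blast
    qed
    show "\<exists>L. L-lipschitz_on {- R..R} (deriv W)" for R by (rule C2_deriv_lipschitz[OF assms(1)])
    show "\<exists>C. C-lipschitz_on UNIV (deriv V)" by (rule C2_periodic_deriv_lipschitz[OF assms(2) per_V])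
    show "deriv V (x + 1) = deriv V x" for x by (rule periodic_deriv[of V, OF per_V])
    show "0 \<le> p t" for t
      using assms(9) by (cases S) (auto simp: p_def intro: order_trans[OF less_imp_le])
    show "bounded (range p)" "bounded (range q)"
      using assms(7) by (cases S; simp add: p_def q_def)+
    have "{a..b} \<inter> N = {x \<in> {a..b}. \<not> isCont K x}" for a b by (auto simp: N_def)
    then show "finite (N \<inter> {a..b})" for a b
      using assms(6) by (simp add: piecewise_continuous_def Int_commute)
    show "isCont p t" "isCont q t" if "t \<notin> N" for t
      using that by (cases S; simp add: p_def q_def N_def)+
    show "p (t + 2 * \<tau>) = p t" "q (t + 2 * \<tau>) = q t" for t
      using per_K by (cases S; simp add: p_def q_def)+
    show "t + 2 * \<tau> \<in> N \<longleftrightarrow> t \<in> N" for t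
      by (simp add: N_def isCont_periodic[of K, OF per_K])
    show "0 < 2 * \<tau>" using assms(5) by simp
  qed
  show ?thesis
  proof (rule transport_speed[OF _ N_def refl])
    show "vector_field S W V K t u k = field t u k" for t u k
      unfolding field_def by (cases S) (simp_all add: p_def q_def interaction_def)
  qed
qed

end
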